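(* Let $\xi$ be a sub-Gaussian complex random variable with density bounded by $K$, and let $G_n=G_n(\xi)$. Let $A\in\mathbb{C}^{n\times n}$ with $\|A\|\le 1$, let $\delta\in(0,1)$, and let $M=A+\delta G_n$. Let $\mathcal{E}_{K'}$ denote the event that $\|G_n\|\le K'$. Then, for $s\le 1$, \[\mathbb{P}[\mathcal{E}_{K'}\cap\{\eta(M)\le s\}]\le c\,\log_2\!\left(2(1+\delta K')/s\right)\cdot(1+\delta K')^2K^4n^6\,\frac{s^2}{\delta^4},\] where $c>0$ is an absolute constant.
   Context: $\|\cdot\|$ denotes the $\ell^2\to\ell^2$ operator norm. A complex random variable $X$ is sub-Gaussian if there are constants $a,b>0$ with $\mathbb{P}[|X|>t]\le be^{-at^2}$ for all $t\ge 0$. The density of $\xi$ (with respect to Lebesgue measure on $\mathbb{C}\cong\mathbb{R}^2$) is continuous and bounded by the constant $K$. $G_n(\xi)$ is the random $n\times n$ matrix such that the entries of $n^{1/2}G_n(\xi)$ are independent copies of $\xi$. For an $n\times n$ matrix $M$ with eigenvalues $\lambda_1,\dots,\lambda_n$ counted with multiplicity, $\eta(M):=\min_{i\ne j}|\lambda_i-\lambda_j|$ is the minimum eigenvalue gap.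
   Formalization: The formal theorem assumes K ≥ 1 (for arbitrary K > 0 no absolute constant c exists: rescale a Gaussian ξ by R and take δ = 1/R, K' = R), and also n ≥ 2, s > 0, K' ≥ 0 so that η(M) and the logarithm make sense. *)

theory Defs
  imports "HOL-Probability.Probability" "Jordan_Normal_Form.Char_Poly"
begin

definition l2_norm :: "complex Matrix.vec \<Rightarrow> real" where
  "l2_norm v = L2_set (\<lambda>i. cmod (vec_index v i)) {..<dim_vec v}"

definition op_norm :: "complex mat \<Rightarrow> real" where
  "op_norm A = (SUP v \<in> {v \<in> carrier_vec (dim_col A). l2_norm v \<le> 1}. l2_norm (A *\<^sub>v v))"

(* Unordered pairs of eigenvalues with distinct indices are the two-element sub-multisets of the
   multiset of roots of the characteristic polynomial; a repeated eigenvalue gives gap 0.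
   Meaningful for matrices of size at least 2, where the set below is finite and nonempty. *)
definition min_eigenvalue_gap :: "complex mat \<Rightarrow> real" where
  "min_eigenvalue_gap A = Min {cmod (x - y) | x y. {#x, y#} \<subseteq># proots (char_poly A)}"

definition sub_gaussian :: "'a measure \<Rightarrow> ('a \<Rightarrow> complex) \<Rightarrow> bool" where
  "sub_gaussian P X \<longleftrightarrow>
     (\<exists>a>0. \<exists>b>0. \<forall>t\<ge>0. measure P {\<omega> \<in> space P. cmod (X \<omega>) > t} \<le> b * exp (- a * t\<^sup>2))"

definition has_continuous_density_bounded_by :: "'a measure \<Rightarrow> ('a \<Rightarrow> complex) \<Rightarrow> real \<Rightarrow> bool" where
  "has_continuous_density_bounded_by P X K \<longleftrightarrow>
     (\<exists>f :: complex \<Rightarrow> real. continuous_on UNIV f \<and> (\<forall>z. 0 \<le> f z \<and> f z \<le> K) \<and>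
        distributed P lborel X (\<lambda>z. ennreal (f z)))"

(* G is a random n x n matrix such that the entries of n^(1/2) G are independent copies of xi.
   Taking xi on the same probability space as G loses no generality: only its law matters,
   and each entry of n^(1/2) G has that law. *)
definition iid_matrix :: "'a measure \<Rightarrow> ('a \<Rightarrow> complex) \<Rightarrow> nat \<Rightarrow> ('a \<Rightarrow> complex mat) \<Rightarrow> bool" where
  "iid_matrix P \<xi> n G \<longleftrightarrow>
     (\<forall>\<omega>\<in>space P. G \<omega> \<in> carrier_mat n n) \<and>
     prob_space.indep_vars P (\<lambda>_. borel)
       (\<lambda>ij \<omega>. complex_of_real (sqrt (real n)) * G \<omega> $$ ij) ({..<n} \<times> {..<n}) \<and>
     (\<forall>ij \<in> {..<n} \<times> {..<n}.
        distr P borel (\<lambda>\<omega>. complex_of_real (sqrt (real n)) * G \<omega> $$ ij) = distr P borel \<xi>)"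

(* Remarks on hypotheses and quantifiers of the gap estimate.

   Since K is only an upper bound for the density, it is normalised by 1 <= K (equivalently, K^4
   is read as (max 1 K)^4).  Without such a normalisation no absolute constant exists: for a
   standard complex Gaussian g put xi = R g, delta = 1/R, A = 0, n = 2, K' = R, s = 1,
   K = 1/(pi R^2).  The left-hand side does not depend on R and is positive, whereas the
   right-hand side is a constant times R^(-4).

   The constant is chosen before all data except the type 'a of sample points.  That
   dependence is harmless: only the joint law of the entries of G matters, and every such law
   occurs on 'a = nat * nat => complex. *)

end

theory Submission
  imports Defs "Jordan_Normal_Form.Schur_Decomposition"
begin

text \<open>
  Why the estimate holds. Suppose that \<open>x\<close> and \<open>y\<close> are eigenvalues of \<open>M\<close>, counted with
  multiplicity, at distance of order \<open>s\<close> from a point \<open>z\<close> that is not an eigenvalue, and let \<open>B\<close> be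
  the inverse of \<open>M - z\<close>. On an invariant plane, \<open>B\<close> has determinant \<open>1 / ((x - z) (y - z))\<close>, of
  modulus at least of order \<open>1 / s\<^sup>2\<close>. This determinant is a matrix coefficient of the second
  exterior power of \<open>B\<close> between unit vectors, so the sum of the \<open>\<bar>D\<bar>\<^sup>2\<close> over all \<open>2 \<times> 2\<close> minors \<open>D\<close> of
  \<open>B\<close> is at least of order \<open>1 / s\<^sup>4\<close> (\<open>inv_minor_sum_ge\<close>). This
  Hilbert-Schmidt norm of the second exterior power takes the place of the two smallest singular
  values of \<open>M - z\<close>.

  Each single minor is easy to control. Fix all entries of \<open>M\<close> outside one \<open>2 \<times> 2\<close> block. By the
  resolvent identity, the corresponding minor \<open>D\<close> of \<open>B\<close> is \<open>1 / det (block - S)\<close> for a fixed \<open>2 \<times> 2\<close>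
  matrix \<open>S\<close> (\<open>inv_minor_block_slice\<close>). The four entries of the block are independent with
  bounded density, so \<open>\<bar>det (block - S)\<bar> \<le> r\<close> has probability \<open>O(r\<^sup>2)\<close>
  (\<open>nn_integral_det2_small_le\<close>), and by Fubini \<open>\<bar>D\<bar>\<^sup>2\<close> exceeds \<open>u\<close> with probability at most
  \<open>C / u\<close>, where \<open>C\<close> is of order \<open>K\<^sup>3 n\<^sup>2 / \<delta>\<^sup>4\<close> (\<open>prob_inv_minor_ge\<close>).

  There are \<open>n\<^sup>4\<close> minors. Adding up variables with a tail \<open>C / u\<close> after truncation costs a factor
  \<open>n\<^sup>4 log t\<close> instead of the \<open>n\<^sup>8\<close> of a plain union bound (\<open>weak_L1_sum_tail\<close>). With \<open>t\<close> of order
  \<open>1 / s\<^sup>4\<close> this bounds the probability for one point \<open>z\<close> by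
  \<open>O(log (2 / s) K\<^sup>3 n\<^sup>6 s\<^sup>4 / \<delta>\<^sup>4)\<close>.

  All eigenvalues lie in the disc of radius \<open>R = 1 + \<delta> K'\<close>, which a grid of mesh \<open>s\<close> covers with
  \<open>O(R\<^sup>2 / s\<^sup>2)\<close> points, and a union bound over the grid finishes the proof. A grid point may happen
  to be an eigenvalue. For this reason the grid is translated by \<open>s / (k + 1)\<close>: for a fixed matrix the
  translated grid meets an eigenvalue for only finitely many \<open>k\<close>, so the event lies in the limit inferior of the events of the
  translated grids, and the uniform bound passes to it (\<open>measure_liminf_le\<close>).
\<close>

section \<open>Tails of sums and of small determinants\<close>

lemma min_le_dyadic_sum:
  fixes x :: real
  shows "min x (2 ^ m) \<le> 1 + (\<Sum>k<m. 2 ^ k * (if 2 ^ k \<le> x then 1 else 0))"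
proof (induction m)
  case 0
  then show ?case by simp
next
  case (Suc m)
  show ?case
  proof (cases "2 ^ m \<le> x")
    case True
    then have "min x (2 ^ m) = 2 ^ m" by simp
    with Suc True show ?thesis by simp
  next
    case False
    moreover have "(2::real) ^ m \<le> 2 ^ Suc m" by simp
    ultimately have "min x (2 ^ Suc m) = min x (2 ^ m)" by linarith
    with Suc False show ?thesis by simp
  qed
qed

text \<open>
  Markov's inequality is applied to the sum of the truncations \<open>min (X i) (2 ^ m)\<close>, which still
  reaches \<open>t\<close> whenever the full sum does. A tail \<open>C / u\<close> does not make \<open>X i\<close> integrable, but each of the
  \<open>m\<close> dyadic levels below the truncation contributes only \<open>C\<close> to the expectation.
\<close>

lemma (in prob_space) weak_L1_sum_tail:
  fixes X :: "'i \<Rightarrow> 'a \<Rightarrow> real"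
  assumes [measurable]: "\<And>i. i \<in> I \<Longrightarrow> X i \<in> borel_measurable M"
    and fin: "finite I" and nonneg: "\<And>i x. i \<in> I \<Longrightarrow> 0 \<le> X i x"
    and tail: "\<And>i u. i \<in> I \<Longrightarrow> 1 \<le> u \<Longrightarrow> prob {x \<in> space M. u \<le> X i x} \<le> C / u"
    and t: "0 < t" "t \<le> 2 ^ m"
  shows "prob {x \<in> space M. t \<le> (\<Sum>i\<in>I. X i x)} \<le> real (card I) * (1 + real m * C) / t"
proof -
  let ?E = "{x \<in> space M. t \<le> (\<Sum>i\<in>I. X i x)}"
  let ?F = "\<lambda>i k. {x \<in> space M. 2 ^ k \<le> X i x}"
  have E[measurable]: "?E \<in> sets M" by measurable
  have F: "?F i k \<in> sets M" if "i \<in> I" for i k using that by measurable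
  have pw: "t * indicator ?E x \<le> (\<Sum>i\<in>I. 1 + (\<Sum>k<m. 2 ^ k * indicator (?F i k) x))" (is "_ \<le> ?R x")
    if x: "x \<in> space M" for x
  proof -
    have "(\<Sum>i\<in>I. min (X i x) (2 ^ m)) \<le> ?R x"
      using x by (intro sum_mono order.trans[OF min_le_dyadic_sum] add_left_mono) (auto simp: indicator_def)
    moreover have "t * indicator ?E x \<le> (\<Sum>i\<in>I. min (X i x) (2 ^ m))"
    proof (cases "x \<in> ?E")
      case True
      have "t \<le> (\<Sum>i\<in>I. min (X i x) (2 ^ m))"
      proof (cases "\<exists>i\<in>I. 2 ^ m \<le> X i x")
        case True
        then obtain i where i: "i \<in> I" "2 ^ m \<le> X i x" by blast
        have "t \<le> min (X i x) (2 ^ m)" using t i by simp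
        also have "\<dots> \<le> (\<Sum>i\<in>I. min (X i x) (2 ^ m))"
          using i fin nonneg by (intro member_le_sum) auto
        finally show ?thesis .
      next
        case False
        then have "(\<Sum>i\<in>I. min (X i x) (2 ^ m)) = (\<Sum>i\<in>I. X i x)"
          by (intro sum.cong) auto
        then show ?thesis using True by simp
      qed
      then show ?thesis using True by simp
    next
      case False
      then show ?thesis using nonneg by (auto intro!: sum_nonneg)
    qed
    ultimately show ?thesis by linarith
  qed
  have intF: "integrable M (indicator (?F i k) :: 'a \<Rightarrow> real)" if "i \<in> I" for i k
    using F[OF that] by (simp add: emeasure_eq_measure)
  have intS: "integrable M (\<lambda>x. 1 + (\<Sum>k<m. 2 ^ k * indicator (?F i k) x :: real))" if "i \<in> I" for i
    by (intro Bochner_Integration.integrable_add Bochner_Integration.integrable_sum integrable_mult_right intF that) simp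
  have intR: "integrable M ?R"
    using intS by (intro Bochner_Integration.integrable_sum)
  have "t * prob ?E = expectation (\<lambda>x. t * indicator ?E x)" by simp
  also have "\<dots> \<le> expectation ?R"
    by (rule integral_mono[OF _ intR pw]) (auto simp: emeasure_eq_measure)
  also have "\<dots> = (\<Sum>i\<in>I. expectation (\<lambda>x. 1 + (\<Sum>k<m. 2 ^ k * indicator (?F i k) x)))"
    using intS by (intro Bochner_Integration.integral_sum)
  also have "\<dots> = (\<Sum>i\<in>I. 1 + (\<Sum>k<m. 2 ^ k * prob (?F i k)))"
  proof (rule sum.cong[OF refl])
    fix i assume i: "i \<in> I"
    have "expectation (\<lambda>x. 1 + (\<Sum>k<m. 2 ^ k * indicator (?F i k) x) :: real)
        = 1 + expectation (\<lambda>x. \<Sum>k<m. 2 ^ k * indicator (?F i k) x)"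
    proof -
      have "integrable M (\<lambda>x. \<Sum>k<m. 2 ^ k * indicator (?F i k) x :: real)"
        by (intro Bochner_Integration.integrable_sum integrable_mult_right intF i)
      then show ?thesis
        by (subst Bochner_Integration.integral_add) (auto simp: prob_space simp del: sum_mult_indicator)
    qed
    also have "expectation (\<lambda>x. \<Sum>k<m. 2 ^ k * indicator (?F i k) x :: real) = (\<Sum>k<m. expectation (\<lambda>x. 2 ^ k * indicator (?F i k) x))"
      using intF[OF i] by (intro Bochner_Integration.integral_sum) (intro integrable_mult_right)
    also have "\<dots> = (\<Sum>k<m. 2 ^ k * prob (?F i k))"
      using F[OF i] by simp
    finally show "expectation (\<lambda>x. 1 + (\<Sum>k<m. 2 ^ k * indicator (?F i k) x)) = 1 + (\<Sum>k<m. 2 ^ k * prob (?F i k))" .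
  qed
  also have "\<dots> \<le> (\<Sum>i\<in>I. 1 + (\<Sum>k<m. C))"
  proof (intro sum_mono add_left_mono)
    fix i k assume "i \<in> I"
    then show "2 ^ k * prob (?F i k) \<le> C"
      using tail[of i "2 ^ k"] by (simp add: field_simps)
  qed
  also have "\<dots> = real (card I) * (1 + real m * C)" by simp
  finally show ?thesis using t by (simp add: field_simps)
qed

text \<open>
  This is what a bounded density means for small determinants: a disc has mass at most proportional to
  its area.
\<close>

locale spread_law = prob_space \<nu> for \<nu> :: "complex measure" +
  fixes \<kappa> :: real
  assumes sets_law[measurable_cong, simp]: "sets \<nu> = sets borel"
    and kappa_nonneg: "0 \<le> \<kappa>"
    and emeasure_cball_le: "0 \<le> r \<Longrightarrow> emeasure \<nu> (cball z r) \<le> ennreal (\<kappa> * r\<^sup>2)"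
begin

lemma space_law [simp]: "space \<nu> = UNIV"
  using sets_eq_imp_space_eq[OF sets_law] by simp

lemma AE_neq: "AE x in \<nu>. x \<noteq> z"
proof -
  have "emeasure \<nu> {z} = 0" using emeasure_cball_le[of 0 z] by simp
  then show ?thesis by (intro AE_I[where N = "{z}"]) auto
qed

text \<open>
  In the plane \<open>1 / \<bar>y - z\<bar>\<close> is integrable against bounded densities: the level \<open>2 ^ k\<close> is exceeded on a
  disc of mass at most \<open>\<kappa> / 4 ^ k\<close>, so the dyadic levels form a geometric series.
\<close>

lemma nn_integral_inverse_dist_le:
  "(\<integral>\<^sup>+y. ennreal (1 / cmod (y - z)) \<partial>\<nu>) \<le> ennreal (1 + 2 * \<kappa>)"
proof -
  let ?B = "\<lambda>k::nat. cball z ((1/2) ^ k)"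
  let ?g = "\<lambda>y. 1 + (\<Sum>k. ennreal (2 ^ k) * indicator (?B k) y)"
  have pw: "ennreal (1 / cmod (y - z)) \<le> ?g y" for y
  proof -
    let ?x = "1 / cmod (y - z)"
    obtain m where m: "?x \<le> 2 ^ m" using real_arch_pow[of 2 ?x] by (auto intro: less_imp_le)
    have "?x \<le> 1 + (\<Sum>k<m. 2 ^ k * (if 2 ^ k \<le> ?x then 1 else 0))"
      using min_le_dyadic_sum[of ?x m] m by simp
    also have "\<dots> \<le> 1 + (\<Sum>k<m. 2 ^ k * indicator (?B k) y)"
    proof (intro add_left_mono sum_mono mult_left_mono)
      fix k
      show "(if 2 ^ k \<le> ?x then 1 else 0) \<le> (indicator (?B k) y :: real)"
      proof (cases "2 ^ k \<le> ?x")
        case True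
        moreover have "(0::real) < 2 ^ k" by simp
        ultimately have "y \<noteq> z" by (metis diff_self div_by_0 norm_zero not_le)
        with True have "cmod (y - z) \<le> (1/2) ^ k" by (simp add: field_simps)
        then show ?thesis by (simp add: dist_norm norm_minus_commute)
      qed simp
    qed simp
    finally have "ennreal ?x \<le> ennreal (1 + (\<Sum>k<m. 2 ^ k * indicator (?B k) y))"
      by (rule ennreal_leI)
    also have "\<dots> = 1 + (\<Sum>k<m. ennreal (2 ^ k) * indicator (?B k) y)"
      by (simp add: ennreal_plus sum_nonneg ennreal_mult ennreal_indicator flip: sum_ennreal)
    also have "\<dots> \<le> ?g y"
      by (intro add_left_mono sum_le_suminf) auto
    finally show ?thesis .
  qed
  have "(\<integral>\<^sup>+y. ennreal (1 / cmod (y - z)) \<partial>\<nu>) \<le> (\<integral>\<^sup>+y. ?g y \<partial>\<nu>)"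
    by (intro nn_integral_mono pw)
  also have "\<dots> = 1 + (\<Sum>k. ennreal (2 ^ k) * emeasure \<nu> (?B k))"
  proof -
    have [measurable]: "?B k \<in> sets \<nu>" for k by simp
    have "(\<integral>\<^sup>+y. ?g y \<partial>\<nu>) = (\<integral>\<^sup>+y. 1 \<partial>\<nu>) + (\<integral>\<^sup>+y. (\<Sum>k. ennreal (2 ^ k) * indicator (?B k) y) \<partial>\<nu>)"
      by (intro nn_integral_add) measurable
    also have "(\<integral>\<^sup>+y. (\<Sum>k. ennreal (2 ^ k) * indicator (?B k) y) \<partial>\<nu>) = (\<Sum>k. \<integral>\<^sup>+y. ennreal (2 ^ k) * indicator (?B k) y \<partial>\<nu>)"
      by (intro nn_integral_suminf) measurable
    also have "\<dots> = (\<Sum>k. ennreal (2 ^ k) * emeasure \<nu> (?B k))"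
      by (intro suminf_cong nn_integral_cmult_indicator) simp
    finally show ?thesis using emeasure_space_1 by simp
  qed
  also have "\<dots> \<le> 1 + (\<Sum>k. ennreal (\<kappa> * (1/2) ^ k))"
  proof (intro add_left_mono suminf_le)
    fix k :: nat
    have "ennreal (2 ^ k) * emeasure \<nu> (?B k) \<le> ennreal (2 ^ k) * ennreal (\<kappa> * ((1/2) ^ k)\<^sup>2)"
      by (intro mult_left_mono emeasure_cball_le) auto
    also have "\<dots> = ennreal (2 ^ k * (\<kappa> * ((1/2) ^ k)\<^sup>2))"
      using kappa_nonneg by (subst ennreal_mult) auto
    also have "2 ^ k * (\<kappa> * ((1/2) ^ k)\<^sup>2) = \<kappa> * (1/2) ^ k"
      by (simp add: power2_eq_square power_divide)
    finally show "ennreal (2 ^ k) * emeasure \<nu> (?B k) \<le> ennreal (\<kappa> * (1/2) ^ k)" .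
  qed auto
  also have "(\<Sum>k. ennreal (\<kappa> * (1/2) ^ k)) = ennreal (\<kappa> * 2)"
    using kappa_nonneg geometric_sums[of "1/2::real"]
    by (intro suminf_ennreal_eq sums_mult) auto
  also have "1 + ennreal (\<kappa> * 2) = ennreal (1 + 2 * \<kappa>)"
    using kappa_nonneg by (simp add: ennreal_plus mult.commute)
  finally show ?thesis .
qed

lemma nn_integral_affine_le:
  assumes "u \<noteq> 0" "0 \<le> r"
  shows "(\<integral>\<^sup>+y. indicator {y. cmod (u * y - w) \<le> r} y \<partial>\<nu>) \<le> ennreal (\<kappa> * r\<^sup>2 / (cmod u)\<^sup>2)"
proof -
  have "{y. cmod (u * y - w) \<le> r} = cball (w / u) (r / cmod u)"
  proof -
    have "cmod (u * y - w) \<le> r \<longleftrightarrow> cmod (y - w / u) \<le> r / cmod u" for y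
    proof -
      have "u * y - w = u * (y - w / u)" using assms by (simp add: field_simps)
      then have "cmod (u * y - w) = cmod u * cmod (y - w / u)" by (simp add: norm_mult)
      then show ?thesis using assms by (simp add: field_simps)
    qed
    then have "{y. cmod (u * y - w) \<le> r} = {y. dist y (w / u) \<le> r / cmod u}"
      unfolding dist_norm by simp
    then show ?thesis by (simp add: cball_def dist_commute)
  qed
  then show ?thesis
    using emeasure_cball_le[of "r / cmod u" "w/u"] assms by (simp add: power_divide)
qed

text \<open>
  For given \<open>a\<close> and \<open>b\<close>, the determinant is affine in \<open>c\<close> and in \<open>d\<close>. Integrating over the variable with
  the larger coefficient gives \<open>\<kappa> r\<^sup>2 / (max \<bar>a - s1\<bar> \<bar>b - s2\<bar>)\<^sup>2\<close>. Using only one of the two coefficients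
  would leave the divergent integral of \<open>1 / \<bar>a - s1\<bar>\<^sup>2\<close> and cost a second logarithm; bounding the
  maximum from below by the geometric mean leaves a product of two convergent integrals.
\<close>

lemma nn_integral_det2_small_le:
  assumes r: "0 \<le> r"
  shows "(\<integral>\<^sup>+a. \<integral>\<^sup>+b. \<integral>\<^sup>+c. \<integral>\<^sup>+d.
      indicator {d. cmod ((a - s1) * (d - s4) - (b - s2) * (c - s3)) \<le> r} d \<partial>\<nu> \<partial>\<nu> \<partial>\<nu> \<partial>\<nu>)
    \<le> ennreal (\<kappa> * (1 + 2 * \<kappa>)\<^sup>2 * r\<^sup>2)"
proof -
  interpret pair_sigma_finite \<nu> \<nu> ..
  let ?E = "\<lambda>a b c d. indicator {d. cmod ((a - s1) * (d - s4) - (b - s2) * (c - s3)) \<le> r} d :: ennreal"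
  let ?h = "\<lambda>z y. ennreal (1 / cmod (y - z))"
  have inner: "(\<integral>\<^sup>+c. \<integral>\<^sup>+d. ?E a b c d \<partial>\<nu> \<partial>\<nu>) \<le> ennreal (\<kappa> * r\<^sup>2) * (?h s1 a * ?h s2 b)"
    if ab: "a \<noteq> s1" "b \<noteq> s2" for a b
  proof -
    let ?A = "cmod (a - s1)" and ?B = "cmod (b - s2)"
    have pos: "?A > 0" "?B > 0" using ab by auto
    have "(\<integral>\<^sup>+c. \<integral>\<^sup>+d. ?E a b c d \<partial>\<nu> \<partial>\<nu>) \<le> ennreal (\<kappa> * r\<^sup>2 / (max ?A ?B)\<^sup>2)"
    proof (cases "?B \<le> ?A")
      case True
      have "(\<integral>\<^sup>+d. ?E a b c d \<partial>\<nu>) \<le> ennreal (\<kappa> * r\<^sup>2 / ?A\<^sup>2)" for c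
        using nn_integral_affine_le[of "a - s1" r "(a - s1) * s4 + (b - s2) * (c - s3)"] ab r
        by (simp add: algebra_simps)
      then have "(\<integral>\<^sup>+c. \<integral>\<^sup>+d. ?E a b c d \<partial>\<nu> \<partial>\<nu>) \<le> (\<integral>\<^sup>+c. ennreal (\<kappa> * r\<^sup>2 / ?A\<^sup>2) \<partial>\<nu>)"
        by (intro nn_integral_mono)
      then show ?thesis using True by (simp add: max_def emeasure_space_1[simplified] split: if_splits)
    next
      case False
      have "(\<integral>\<^sup>+c. ?E a b c d \<partial>\<nu>) \<le> ennreal (\<kappa> * r\<^sup>2 / ?B\<^sup>2)" for d
      proof -
        have "?E a b c d = indicator {c. cmod ((b - s2) * c - ((b - s2) * s3 + (a - s1) * (d - s4))) \<le> r} c" for c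
        proof -
          have "cmod ((b - s2) * c - ((b - s2) * s3 + (a - s1) * (d - s4)))
            = cmod ((a - s1) * (d - s4) - (b - s2) * (c - s3))"
            by (subst norm_minus_commute) (simp add: algebra_simps)
          then show ?thesis by (simp add: indicator_def)
        qed
        then show ?thesis using nn_integral_affine_le[of "b - s2" r] ab r by simp
      qed
      then have "(\<integral>\<^sup>+d. \<integral>\<^sup>+c. ?E a b c d \<partial>\<nu> \<partial>\<nu>) \<le> (\<integral>\<^sup>+d. ennreal (\<kappa> * r\<^sup>2 / ?B\<^sup>2) \<partial>\<nu>)"
        by (intro nn_integral_mono)
      moreover have "(\<integral>\<^sup>+c. \<integral>\<^sup>+d. ?E a b c d \<partial>\<nu> \<partial>\<nu>) = (\<integral>\<^sup>+d. \<integral>\<^sup>+c. ?E a b c d \<partial>\<nu> \<partial>\<nu>)"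
        by (rule Fubini') measurable
      ultimately show ?thesis using False by (simp add: max_def emeasure_space_1[simplified])
    qed
    also have "\<kappa> * r\<^sup>2 / (max ?A ?B)\<^sup>2 \<le> \<kappa> * r\<^sup>2 * (1 / ?A * (1 / ?B))"
    proof -
      have "?A * ?B \<le> (max ?A ?B)\<^sup>2" unfolding power2_eq_square
        using pos by (intro mult_mono) (auto simp: le_max_iff_disj)
      then have "1 / (max ?A ?B)\<^sup>2 \<le> 1 / (?A * ?B)" using pos
        by (intro divide_left_mono mult_pos_pos zero_less_power) (auto simp: less_max_iff_disj)
      then have "\<kappa> * r\<^sup>2 * (1 / (max ?A ?B)\<^sup>2) \<le> \<kappa> * r\<^sup>2 * (1 / (?A * ?B))"
        using kappa_nonneg by (intro mult_left_mono) auto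
      then show ?thesis by simp
    qed
    then have "ennreal (\<kappa> * r\<^sup>2 / (max ?A ?B)\<^sup>2) \<le> ennreal (\<kappa> * r\<^sup>2 * (1 / ?A * (1 / ?B)))"
      by (rule ennreal_leI)
    also have "\<dots> = ennreal (\<kappa> * r\<^sup>2) * (?h s1 a * ?h s2 b)"
      using kappa_nonneg by (simp only: ennreal_mult' ennreal_mult'' zero_le_divide_1_iff norm_ge_zero zero_le_power2 mult_nonneg_nonneg)
    finally show ?thesis .
  qed
  have "(\<integral>\<^sup>+a. \<integral>\<^sup>+b. \<integral>\<^sup>+c. \<integral>\<^sup>+d. ?E a b c d \<partial>\<nu> \<partial>\<nu> \<partial>\<nu> \<partial>\<nu>)
     \<le> (\<integral>\<^sup>+a. \<integral>\<^sup>+b. ennreal (\<kappa> * r\<^sup>2) * (?h s1 a * ?h s2 b) \<partial>\<nu> \<partial>\<nu>)"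
  proof (rule nn_integral_mono_AE, use AE_neq[of s1] in eventually_elim)
    case (elim a)
    show ?case
      by (rule nn_integral_mono_AE, use AE_neq[of s2] in eventually_elim) (use inner elim in blast)
  qed
  also have "\<dots> = ennreal (\<kappa> * r\<^sup>2) * ((\<integral>\<^sup>+a. ?h s1 a \<partial>\<nu>) * (\<integral>\<^sup>+b. ?h s2 b \<partial>\<nu>))"
    by (simp add: nn_integral_cmult nn_integral_multc)
  also have "\<dots> \<le> ennreal (\<kappa> * r\<^sup>2) * (ennreal (1 + 2 * \<kappa>) * ennreal (1 + 2 * \<kappa>))"
    by (intro mult_left_mono mult_mono nn_integral_inverse_dist_le) auto
  also have "\<dots> = ennreal (\<kappa> * (1 + 2 * \<kappa>)\<^sup>2 * r\<^sup>2)"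
  proof -
    have "ennreal (\<kappa> * r\<^sup>2) * (ennreal (1 + 2 * \<kappa>) * ennreal (1 + 2 * \<kappa>))
      = ennreal (\<kappa> * r\<^sup>2 * ((1 + 2 * \<kappa>) * (1 + 2 * \<kappa>)))"
      using kappa_nonneg by (simp only: ennreal_mult mult_nonneg_nonneg zero_le_power2 add_nonneg_nonneg zero_le_one zero_le_numeral)
    then show ?thesis by (simp add: power2_eq_square mult_ac)
  qed
  finally show ?thesis .
qed

text \<open>
  Fubini for the four block coordinates: the matrix \<open>s\<close> may depend on the other coordinates in any,
  possibly non-measurable, way, since only the resulting bound is integrated.
\<close>

lemma emeasure_PiM_det2_le:
  assumes fin: "finite I" and r: "0 \<le> r"
    and p: "distinct [p1, p2, p3, p4]" "{p1, p2, p3, p4} \<subseteq> I"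
    and Q[measurable]: "Q \<in> sets (Pi\<^sub>M I (\<lambda>_. \<nu>))"
    and slice: "\<And>y. \<exists>s1 s2 s3 s4. \<forall>a b c d. y(p1 := a, p2 := b, p3 := c, p4 := d) \<in> Q \<longrightarrow>
        cmod ((a - s1) * (d - s4) - (b - s2) * (c - s3)) \<le> r"
  shows "emeasure (Pi\<^sub>M I (\<lambda>_. \<nu>)) Q \<le> ennreal (\<kappa> * (1 + 2 * \<kappa>)\<^sup>2 * r\<^sup>2)"
proof -
  interpret P: product_prob_space "\<lambda>_. \<nu>" I ..
  define J where "J = I - {p1, p2, p3, p4}"
  have J: "finite J" "I = insert p4 (insert p3 (insert p2 (insert p1 J)))"
    "p1 \<notin> J" "p2 \<notin> insert p1 J" "p3 \<notin> insert p2 (insert p1 J)"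
    "p4 \<notin> insert p3 (insert p2 (insert p1 J))"
    using fin p by (auto simp: J_def)
  let ?q = "indicator Q :: _ \<Rightarrow> ennreal"
  have m4: "?q \<in> borel_measurable (Pi\<^sub>M (insert p4 (insert p3 (insert p2 (insert p1 J)))) (\<lambda>_. \<nu>))"
    using Q J(2) by simp
  then have m4'[measurable]: "(\<lambda>(y,d). ?q (y(p4 := d))) \<in> borel_measurable (Pi\<^sub>M (insert p3 (insert p2 (insert p1 J))) (\<lambda>_. \<nu>) \<Otimes>\<^sub>M \<nu>)"
    by measurable
  have m3: "(\<lambda>y. \<integral>\<^sup>+d. ?q (y(p4 := d)) \<partial>\<nu>) \<in> borel_measurable (Pi\<^sub>M (insert p3 (insert p2 (insert p1 J))) (\<lambda>_. \<nu>))"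
    by measurable
  then have [measurable]: "(\<lambda>(y,c). (\<lambda>y. \<integral>\<^sup>+d. ?q (y(p4 := d)) \<partial>\<nu>) (y(p3 := c))) \<in> borel_measurable (Pi\<^sub>M (insert p2 (insert p1 J)) (\<lambda>_. \<nu>) \<Otimes>\<^sub>M \<nu>)"
    unfolding split_def by (rule measurable_compose[rotated]) measurable
  have m2: "(\<lambda>y. \<integral>\<^sup>+c. \<integral>\<^sup>+d. ?q (y(p3 := c, p4 := d)) \<partial>\<nu> \<partial>\<nu>) \<in> borel_measurable (Pi\<^sub>M (insert p2 (insert p1 J)) (\<lambda>_. \<nu>))"
    by measurable
  then have [measurable]: "(\<lambda>(y,b). (\<lambda>y. \<integral>\<^sup>+c. \<integral>\<^sup>+d. ?q (y(p3 := c, p4 := d)) \<partial>\<nu> \<partial>\<nu>) (y(p2 := b))) \<in> borel_measurable (Pi\<^sub>M (insert p1 J) (\<lambda>_. \<nu>) \<Otimes>\<^sub>M \<nu>)"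
    unfolding split_def by (rule measurable_compose[rotated]) measurable
  have m1: "(\<lambda>y. \<integral>\<^sup>+b. \<integral>\<^sup>+c. \<integral>\<^sup>+d. ?q (y(p2 := b, p3 := c, p4 := d)) \<partial>\<nu> \<partial>\<nu> \<partial>\<nu>) \<in> borel_measurable (Pi\<^sub>M (insert p1 J) (\<lambda>_. \<nu>))"
    by measurable
  interpret PJ: product_prob_space "\<lambda>_. \<nu>" J ..
  have "emeasure (Pi\<^sub>M I (\<lambda>_. \<nu>)) Q = integral\<^sup>N (Pi\<^sub>M I (\<lambda>_. \<nu>)) ?q"
    by simp
  also have "\<dots> = (\<integral>\<^sup>+y. \<integral>\<^sup>+a. \<integral>\<^sup>+b. \<integral>\<^sup>+c. \<integral>\<^sup>+d. ?q (y(p1 := a, p2 := b, p3 := c, p4 := d)) \<partial>\<nu> \<partial>\<nu> \<partial>\<nu> \<partial>\<nu> \<partial>(Pi\<^sub>M J (\<lambda>_. \<nu>)))"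
    unfolding J(2)
    apply (subst P.product_nn_integral_insert[OF _ J(6) m4], use J in simp)
    apply (subst P.product_nn_integral_insert[OF _ J(5) m3], use J in simp)
    apply (subst P.product_nn_integral_insert[OF _ J(4) m2], use J in simp)
    apply (subst P.product_nn_integral_insert[OF _ J(3) m1], use J in simp)
    by simp
  also have "\<dots> \<le> (\<integral>\<^sup>+y. ennreal (\<kappa> * (1 + 2 * \<kappa>)\<^sup>2 * r\<^sup>2) \<partial>(Pi\<^sub>M J (\<lambda>_. \<nu>)))"
  proof (rule nn_integral_mono)
    fix y :: "'a \<Rightarrow> complex"
    obtain s1 s2 s3 s4 where s: "\<And>a b c d. y(p1 := a, p2 := b, p3 := c, p4 := d) \<in> Q \<Longrightarrow>
        cmod ((a - s1) * (d - s4) - (b - s2) * (c - s3)) \<le> r"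
      using slice[of y] by blast
    have "(\<integral>\<^sup>+a. \<integral>\<^sup>+b. \<integral>\<^sup>+c. \<integral>\<^sup>+d. ?q (y(p1 := a, p2 := b, p3 := c, p4 := d)) \<partial>\<nu> \<partial>\<nu> \<partial>\<nu> \<partial>\<nu>)
      \<le> (\<integral>\<^sup>+a. \<integral>\<^sup>+b. \<integral>\<^sup>+c. \<integral>\<^sup>+d. indicator {d. cmod ((a - s1) * (d - s4) - (b - s2) * (c - s3)) \<le> r} d \<partial>\<nu> \<partial>\<nu> \<partial>\<nu> \<partial>\<nu>)"
      using s by (intro nn_integral_mono) (auto simp: indicator_def)
    also note nn_integral_det2_small_le[OF r]
    finally show "(\<integral>\<^sup>+a. \<integral>\<^sup>+b. \<integral>\<^sup>+c. \<integral>\<^sup>+d. ?q (y(p1 := a, p2 := b, p3 := c, p4 := d)) \<partial>\<nu> \<partial>\<nu> \<partial>\<nu> \<partial>\<nu>)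
       \<le> ennreal (\<kappa> * (1 + 2 * \<kappa>)\<^sup>2 * r\<^sup>2)" .
  qed
  also have "\<dots> = ennreal (\<kappa> * (1 + 2 * \<kappa>)\<^sup>2 * r\<^sup>2)"
    using PJ.emeasure_space_1 by simp
  finally show ?thesis .
qed

end

lemma bounded_density_imp_spread_law:
  assumes "prob_space P" and "has_continuous_density_bounded_by P X K" and K: "0 \<le> K"
  shows "spread_law (distr P borel X) (pi * K)"
proof -
  interpret prob_space P by fact
  obtain f where f: "continuous_on UNIV f" "\<And>z. 0 \<le> f z" "\<And>z. f z \<le> K"
    and d: "distributed P lborel X (\<lambda>z. ennreal (f z))"
    using assms(2) unfolding has_continuous_density_bounded_by_def by blast
  have X[measurable]: "X \<in> borel_measurable P" using distributed_measurable[OF d] by simp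
  have fm[measurable]: "f \<in> borel_measurable borel" using f(1) by (rule borel_measurable_continuous_onI)
  have e: "distr P borel X = density lborel (\<lambda>z. ennreal (f z))"
    using distributed_distr_eq_density[OF d] by (simp cong: distr_cong)
  show ?thesis
  proof (rule spread_law.intro[OF prob_space_distr[OF X]], unfold_locales)
    fix r :: real and z :: complex assume r: "0 \<le> r"
    have "emeasure (distr P borel X) (cball z r) = (\<integral>\<^sup>+x. ennreal (f x) * indicator (cball z r) x \<partial>lborel)"
      unfolding e by (subst emeasure_density) auto
    also have "\<dots> \<le> (\<integral>\<^sup>+x. ennreal K * indicator (cball z r) x \<partial>lborel)"
      using f by (intro nn_integral_mono mult_right_mono ennreal_leI) auto
    also have "\<dots> = ennreal (pi * K * r\<^sup>2)"
    proof -
      have "(\<integral>\<^sup>+x. ennreal K * indicator (cball z r) x \<partial>lborel) = ennreal K * ennreal (pi * r\<^sup>2)"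
        using r by (simp add: nn_integral_cmult_indicator emeasure_cball unit_ball_vol_2)
      also have "\<dots> = ennreal (pi * K * r\<^sup>2)"
        using K by (simp add: mult_ac flip: ennreal_mult')
      finally show ?thesis .
    qed
    finally show "emeasure (distr P borel X) (cball z r) \<le> ennreal (pi * K * r\<^sup>2)" .
  qed (use K in auto)
qed

section \<open>Minors of the inverse of a matrix with two nearby eigenvalues\<close>

lemma sum_quad:
  fixes f :: "_ \<Rightarrow> 'a :: comm_monoid_add"
  shows "(\<Sum>x\<in>{..<n::nat} \<times> {..<n} \<times> {..<n} \<times> {..<n}. f x)
    = (\<Sum>i<n. \<Sum>k<n. \<Sum>j<n. \<Sum>l<n. f (i,k,j,l))"
  by (simp add: sum.cartesian_product split_def)

text \<open>
  The right-hand side is the squared Hilbert-Schmidt norm of the second exterior power of \<open>a\<close>, up to a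
  constant because index pairs are ordered here. Since \<open>a u\<close> is orthogonal to \<open>v\<close>, the product \<open>\<alpha> \<beta>\<close> is the
  determinant of the compression of \<open>a\<close> to the plane of \<open>u\<close> and \<open>v\<close>. Expanding it in the entries
  gives a pairing of the minors with a tensor of norm one, and Cauchy-Schwarz applies.
\<close>

lemma compound_norm_ge_orthonormal:
  fixes a :: "nat \<Rightarrow> nat \<Rightarrow> complex" and u v :: "nat \<Rightarrow> complex"
  assumes u: "(\<Sum>i<n. (cmod (u i))\<^sup>2) = 1" and v: "(\<Sum>i<n. (cmod (v i))\<^sup>2) = 1"
    and orth: "(\<Sum>i<n. cnj (v i) * u i) = 0"
    and au: "\<And>i. i < n \<Longrightarrow> (\<Sum>j<n. a i j * u j) = \<alpha> * u i"
    and av: "\<And>i. i < n \<Longrightarrow> (\<Sum>j<n. a i j * v j) = \<beta> * v i + \<tau> * u i"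
  shows "(cmod (\<alpha> * \<beta>))\<^sup>2 \<le> (\<Sum>i<n. \<Sum>k<n. \<Sum>j<n. \<Sum>l<n. (cmod (a i j * a k l - a i l * a k j))\<^sup>2)"
proof -
  let ?I = "{..<n} \<times> {..<n} \<times> {..<n} \<times> {..<n}"
  define w where "w = (\<lambda>(i,k,j,l). cnj (u i) * cnj (v k) * u j * v l)"
  define D where "D = (\<lambda>(i,k,j,l). a i j * a k l - a i l * a k j)"
  have uu: "(\<Sum>i<n. cnj (u i) * u i) = 1"
    using u by (simp add: complex_norm_square mult.commute flip: of_real_sum of_real_power)
       (metis (mono_tags, lifting) of_real_1 of_real_sum sum.cong complex_norm_square)
  have vv: "(\<Sum>i<n. cnj (v i) * v i) = 1"
    using v by (simp add: complex_norm_square mult.commute flip: of_real_sum of_real_power)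
       (metis (mono_tags, lifting) of_real_1 of_real_sum sum.cong complex_norm_square)
  have uv: "(\<Sum>i<n. cnj (u i) * v i) = 0"
    using arg_cong[OF orth, of cnj] by (simp add: mult.commute)
  have "(\<Sum>x\<in>?I. w x * D x) = (\<Sum>i<n. \<Sum>k<n. \<Sum>j<n. \<Sum>l<n.
      (cnj (u i) * (a i j * u j)) * (cnj (v k) * (a k l * v l))
      - (cnj (u i) * (a i l * v l)) * (cnj (v k) * (a k j * u j)))"
    by (simp add: sum_quad w_def D_def algebra_simps cong: sum.cong)
  also have "\<dots> = (\<Sum>i<n. \<Sum>k<n. (cnj (u i) * (\<Sum>j<n. a i j * u j)) * (cnj (v k) * (\<Sum>l<n. a k l * v l)))
      - (\<Sum>i<n. \<Sum>k<n. (cnj (u i) * (\<Sum>l<n. a i l * v l)) * (cnj (v k) * (\<Sum>j<n. a k j * u j)))"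
  proof -
    have 1: "(\<Sum>j<n. \<Sum>l<n. cnj (u i) * (a i j * u j) * (cnj (v k) * (a k l * v l)))
      = (cnj (u i) * (\<Sum>j<n. a i j * u j)) * (cnj (v k) * (\<Sum>l<n. a k l * v l))" for i k
      by (simp only: sum_distrib_left[symmetric] sum_distrib_right[symmetric])
    have 2: "(\<Sum>j<n. \<Sum>l<n. cnj (u i) * (a i l * v l) * (cnj (v k) * (a k j * u j)))
      = (cnj (u i) * (\<Sum>l<n. a i l * v l)) * (cnj (v k) * (\<Sum>j<n. a k j * u j))" for i k
      by (subst sum.swap) (simp only: sum_distrib_left[symmetric] sum_distrib_right[symmetric])
    show ?thesis by (simp only: sum_subtractf 1 2)
  qed
  also have "\<dots> = (\<Sum>i<n. cnj (u i) * (\<Sum>j<n. a i j * u j)) * (\<Sum>k<n. cnj (v k) * (\<Sum>l<n. a k l * v l))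
      - (\<Sum>i<n. cnj (u i) * (\<Sum>l<n. a i l * v l)) * (\<Sum>k<n. cnj (v k) * (\<Sum>j<n. a k j * u j))"
    by (simp only: sum_product)
  also have "(\<Sum>i<n. cnj (u i) * (\<Sum>j<n. a i j * u j)) = (\<Sum>i<n. \<alpha> * (cnj (u i) * u i))"
    by (intro sum.cong) (auto simp: au)
  also have "\<dots> = \<alpha>" by (simp only: uu sum_distrib_left[symmetric] mult_1_right)
  also have "(\<Sum>k<n. cnj (v k) * (\<Sum>j<n. a k j * u j)) = (\<Sum>i<n. \<alpha> * (cnj (v i) * u i))"
    by (intro sum.cong) (auto simp: au)
  also have "\<dots> = 0" by (simp only: orth sum_distrib_left[symmetric] mult_zero_right)
  also have "(\<Sum>k<n. cnj (v k) * (\<Sum>l<n. a k l * v l)) = (\<Sum>i<n. \<beta> * (cnj (v i) * v i) + \<tau> * (cnj (v i) * u i))"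
  proof (intro sum.cong refl)
    fix k assume "k \<in> {..<n}"
    then have "(\<Sum>l<n. a k l * v l) = \<beta> * v k + \<tau> * u k" by (intro av) simp
    then show "cnj (v k) * (\<Sum>l<n. a k l * v l) = \<beta> * (cnj (v k) * v k) + \<tau> * (cnj (v k) * u k)"
      by (simp only: distrib_left mult_ac)
  qed
  also have "\<dots> = \<beta>"
    by (simp only: orth vv sum.distrib sum_distrib_left[symmetric] mult_zero_right mult_1_right add_0_right)
  finally have key: "\<alpha> * \<beta> = (\<Sum>x\<in>?I. w x * D x)" by simp
  have "cmod (\<alpha> * \<beta>) \<le> (\<Sum>x\<in>?I. cmod (w x) * cmod (D x))"
    unfolding key by (rule order.trans[OF norm_sum]) (simp add: norm_mult)
  then have "(cmod (\<alpha> * \<beta>))\<^sup>2 \<le> (\<Sum>x\<in>?I. cmod (w x) * cmod (D x))\<^sup>2"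
    by (intro power_mono) auto
  also have "\<dots> \<le> (\<Sum>x\<in>?I. (cmod (w x))\<^sup>2) * (\<Sum>x\<in>?I. (cmod (D x))\<^sup>2)"
    by (rule Cauchy_Schwarz_ineq_sum)
  also have "(\<Sum>x\<in>?I. (cmod (w x))\<^sup>2) = (\<Sum>i<n. \<Sum>k<n. \<Sum>j<n. \<Sum>l<n. ((cmod (u i))\<^sup>2 * (cmod (v k))\<^sup>2 * ((cmod (u j))\<^sup>2 * (cmod (v l))\<^sup>2)))"
    by (simp add: sum_quad w_def norm_mult power_mult_distrib mult_ac cong: sum.cong)
  also have "\<dots> = 1"
    by (simp only: sum_distrib_left[symmetric] u v mult_1_right)
  also have "(\<Sum>x\<in>?I. (cmod (D x))\<^sup>2) = (\<Sum>i<n. \<Sum>k<n. \<Sum>j<n. \<Sum>l<n. (cmod (a i j * a k l - a i l * a k j))\<^sup>2)"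
    by (simp add: sum_quad D_def cong: sum.cong)
  finally show ?thesis by simp
qed

lemma compound_norm_ge_triangular:
  fixes a :: "nat \<Rightarrow> nat \<Rightarrow> complex" and p q :: "nat \<Rightarrow> complex"
  assumes ap: "\<And>i. i < n \<Longrightarrow> (\<Sum>j<n. a i j * p j) = \<alpha> * p i"
    and aq: "\<And>i. i < n \<Longrightarrow> (\<Sum>j<n. a i j * q j) = \<beta> * q i + \<tau> * p i"
    and p: "\<exists>i<n. p i \<noteq> 0" and pq: "\<And>c. \<exists>i<n. q i \<noteq> c * p i"
  shows "(cmod (\<alpha> * \<beta>))\<^sup>2 \<le> (\<Sum>i<n. \<Sum>k<n. \<Sum>j<n. \<Sum>l<n. (cmod (a i j * a k l - a i l * a k j))\<^sup>2)"
proof -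
  define s where "s = (\<Sum>i<n. (cmod (p i))\<^sup>2)"
  have s: "s > 0" using p unfolding s_def by (intro sum_pos2[of _ "SOME i. i < n \<and> p i \<noteq> 0"]) (auto dest!: someI_ex)
  define c where "c = (\<Sum>i<n. cnj (p i) * q i) / of_real s"
  define q' where "q' = (\<lambda>i. q i - c * p i)"
  define t where "t = (\<Sum>i<n. (cmod (q' i))\<^sup>2)"
  obtain i0 where "i0 < n" "q i0 \<noteq> c * p i0" using pq by blast
  then have t: "t > 0" unfolding t_def by (intro sum_pos2[of _ i0]) (auto simp: q'_def)
  define f where "f = (of_real (1 / sqrt s) :: complex)"
  define g where "g = (of_real (1 / sqrt t) :: complex)"
  have f0: "f \<noteq> 0" and g0: "g \<noteq> 0" using s t by (auto simp: f_def g_def)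
  have f2: "(cmod f)\<^sup>2 = 1 / s" and g2: "(cmod g)\<^sup>2 = 1 / t"
    using s t by (simp_all add: f_def g_def power_divide norm_divide)
  have ps: "(\<Sum>i<n. cnj (p i) * p i) = of_real s"
    unfolding s_def by (simp add: complex_norm_square mult.commute del: of_real_power)
  have "(\<Sum>i<n. cnj (p i) * q' i) = (\<Sum>i<n. cnj (p i) * q i) - c * (\<Sum>i<n. cnj (p i) * p i)"
    by (simp add: q'_def algebra_simps sum_subtractf sum_distrib_left)
  also have "\<dots> = 0" using s by (simp add: ps c_def)
  finally have pq': "(\<Sum>i<n. cnj (p i) * q' i) = 0" .
  show ?thesis
  proof (rule compound_norm_ge_orthonormal[where u = "\<lambda>i. f * p i" and v = "\<lambda>i. g * q' i"
        and \<tau> = "g * (\<beta> * c + \<tau> - c * \<alpha>) / f"])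
    show "(\<Sum>i<n. (cmod (f * p i))\<^sup>2) = 1"
      using s by (simp only: norm_mult power_mult_distrib f2 sum_distrib_left[symmetric] s_def[symmetric]) simp
    show "(\<Sum>i<n. (cmod (g * q' i))\<^sup>2) = 1"
      using t by (simp only: norm_mult power_mult_distrib g2 sum_distrib_left[symmetric] t_def[symmetric]) simp
    have "(\<Sum>i<n. cnj (g * q' i) * (f * p i)) = cnj g * f * cnj (\<Sum>i<n. cnj (p i) * q' i)"
      by (simp add: sum_distrib_left mult_ac)
    then show "(\<Sum>i<n. cnj (g * q' i) * (f * p i)) = 0" by (simp add: pq' del: cnj_sum)
    show "(\<Sum>j<n. a i j * (f * p j)) = \<alpha> * (f * p i)" if "i < n" for i
    proof -
      have "(\<Sum>j<n. a i j * (f * p j)) = f * (\<Sum>j<n. a i j * p j)"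
        by (simp add: sum_distrib_left mult_ac)
      then show ?thesis using ap[OF that] by simp
    qed
    show "(\<Sum>j<n. a i j * (g * q' j)) = \<beta> * (g * q' i) + g * (\<beta> * c + \<tau> - c * \<alpha>) / f * (f * p i)" if "i < n" for i
    proof -
      have "(\<Sum>j<n. a i j * (g * q' j)) = g * ((\<Sum>j<n. a i j * q j) - c * (\<Sum>j<n. a i j * p j))"
        by (simp add: q'_def sum_distrib_left sum_subtractf algebra_simps)
      also have "\<dots> = g * (\<beta> * q i + \<tau> * p i - c * (\<alpha> * p i))"
        by (simp only: ap[OF that] aq[OF that])
      finally have e: "(\<Sum>j<n. a i j * (g * q' j)) = g * (\<beta> * q i + \<tau> * p i - c * (\<alpha> * p i))" .
      have "g * (\<beta> * c + \<tau> - c * \<alpha>) / f * (f * p i) = g * (\<beta> * c + \<tau> - c * \<alpha>) * p i"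
        using f0 by simp
      then show ?thesis unfolding e by (simp add: q'_def algebra_simps)
    qed
  qed
qed

text \<open>
  A Schur decomposition can list the eigenvalues in any order, so \<open>x\<close> and \<open>y\<close> may be put first; the
  first two columns of the change of basis are \<open>p\<close> and \<open>q\<close>. This also covers a repeated eigenvalue
  with a single eigenvector.
\<close>

lemma triangular_pair_of_roots:
  assumes M: "M \<in> carrier_mat n n" and xy: "{#x, y#} \<subseteq># proots (char_poly M)"
  shows "\<exists>p q :: nat \<Rightarrow> complex. \<exists>c.
    (\<forall>i<n. (\<Sum>j<n. M $$ (i,j) * p j) = x * p i) \<and>
    (\<forall>i<n. (\<Sum>j<n. M $$ (i,j) * q j) = y * q i + c * p i) \<and>
    (\<exists>i<n. p i \<noteq> 0) \<and> (\<forall>c. \<exists>i<n. q i \<noteq> c * p i)"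
proof -
  obtain as where as: "char_poly M = (\<Prod>a\<leftarrow>as. [:- a, 1:])" "length as = n"
    using char_poly_factorized[OF M] by blast
  have "proots (char_poly M) = mset as"
  proof -
    have "proots (\<Prod>a\<leftarrow>as. [:- a, 1:]) = mset as"
    proof (induction as)
      case (Cons b as)
      have "monic (\<Prod>a\<leftarrow>as. [:- a, 1:])" by (intro monic_prod_list) auto
      then have "(\<Prod>a\<leftarrow>as. [:- a, 1:]) \<noteq> 0" by auto
      then have "proots ([:- b, 1:] * (\<Prod>a\<leftarrow>as. [:- a, 1:])) = proots [:- b, 1:] + proots (\<Prod>a\<leftarrow>as. [:- a, 1:])"
        by (intro proots_mult) auto
      then show ?case using Cons by (simp del: mult_pCons_left)
    qed simp
    then show ?thesis by (simp add: as)
  qed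
  then obtain R where R: "mset as = {#x, y#} + R"
    using xy by (metis mset_subset_eq_exists_conv)
  obtain rs where rs: "mset rs = R" using ex_mset by blast
  define es where "es = x # y # rs"
  have es: "mset es = mset as" by (simp add: es_def R rs)
  have ces: "char_poly M = (\<Prod>e\<leftarrow>es. [:- e, 1:])"
    unfolding as(1) using es by (metis mset_map prod_mset_prod_list)
  have n: "2 \<le> n" using as(2) arg_cong[OF es, of size] by (simp add: es_def)
  obtain B P Q where "schur_decomposition M es = (B,P,Q)" by (metis prod_cases3)
  from schur_decomposition[OF M ces this]
  have wit: "similar_mat_wit M B P Q" and ut: "upper_triangular B" and diag: "diag_mat B = es" by auto
  from similar_mat_witD2[OF M wit]
  have PQ: "Q * P = 1\<^sub>m n" "M = P * B * Q" "B \<in> carrier_mat n n" "P \<in> carrier_mat n n" "Q \<in> carrier_mat n n"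
    by auto
  have MP: "M * P = P * B"
  proof -
    have "M * P = P * B * (Q * P)" using PQ by (simp add: assoc_mult_mat[of _ n n _ n _ n])
    then show ?thesis using PQ by simp
  qed
  have ent: "(\<Sum>j<n. M $$ (i,j) * P $$ (j,k)) = (\<Sum>j<n. P $$ (i,j) * B $$ (j,k))" if "i < n" "k < n" for i k
    using arg_cong[OF MP, of "\<lambda>X. X $$ (i,k)"] that M PQ
    by (simp add: scalar_prod_def atLeast0LessThan)
  have QP: "(\<Sum>j<n. Q $$ (i,j) * P $$ (j,k)) = (if i = k then 1 else 0)" if "i < n" "k < n" for i k
    using arg_cong[OF PQ(1), of "\<lambda>X. X $$ (i,k)"] that PQ(4,5)
    by (simp add: scalar_prod_def atLeast0LessThan)
  have B0: "B $$ (0,0) = x" and B1: "B $$ (1,1) = y"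
    using arg_cong[OF diag, of "\<lambda>l. l ! 0"] arg_cong[OF diag, of "\<lambda>l. l ! 1"] n PQ
    by (simp_all add: diag_mat_def es_def)
  have Bz: "B $$ (j,k) = 0" if "k < j" "j < n" for j k using ut that PQ by auto
  show ?thesis
  proof (rule exI[of _ "\<lambda>i. P $$ (i,0)"], rule exI[of _ "\<lambda>i. P $$ (i,1)"], rule exI[of _ "B $$ (0,1)"],
      intro conjI allI impI)
    fix i assume i: "i < n"
    have "(\<Sum>j<n. P $$ (i,j) * B $$ (j,0)) = (\<Sum>j\<in>{0}. P $$ (i,j) * B $$ (j,0))"
      using n by (intro sum.mono_neutral_right) (auto simp: Bz)
    then show "(\<Sum>j<n. M $$ (i,j) * P $$ (j,0)) = x * P $$ (i,0)"
      using ent[of i 0] i n by (simp add: B0)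
    have "(\<Sum>j<n. P $$ (i,j) * B $$ (j,1)) = (\<Sum>j\<in>{0,1}. P $$ (i,j) * B $$ (j,1))"
      using n by (intro sum.mono_neutral_right) (auto simp: Bz)
    then show "(\<Sum>j<n. M $$ (i,j) * P $$ (j,1)) = y * P $$ (i,1) + B $$ (0,1) * P $$ (i,0)"
      using ent[of i 1] i n B1 by simp
  next
    show "\<exists>i<n. P $$ (i,0) \<noteq> 0"
    proof (rule ccontr)
      assume "\<not> ?thesis"
      then have "(\<Sum>j<n. Q $$ (0,j) * P $$ (j,0)) = 0" by (intro sum.neutral) auto
      then show False using QP[of 0 0] n by simp
    qed
  next
    fix c
    show "\<exists>i<n. P $$ (i,1) \<noteq> c * P $$ (i,0)"
    proof (rule ccontr)
      assume "\<not> ?thesis"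
      then have "(\<Sum>j<n. Q $$ (1,j) * P $$ (j,1)) = (\<Sum>j<n. c * (Q $$ (1,j) * P $$ (j,0)))" by (intro sum.cong) auto
      also have "\<dots> = c * (\<Sum>j<n. Q $$ (1,j) * P $$ (j,0))" by (simp add: sum_distrib_left)
      finally show False using QP[of 1 1] QP[of 1 0] n by simp
    qed
  qed
qed

text \<open>
  Cramer's rule as a definition makes the entries of the inverse visibly measurable in those of \<open>N\<close>.
  For singular \<open>N\<close> the value is \<open>0\<close>, so a nonzero minor certifies invertibility.
\<close>

definition inv_entry :: "complex mat \<Rightarrow> nat \<Rightarrow> nat \<Rightarrow> complex" where
  "inv_entry N i j = adj_mat N $$ (i, j) / det N"

text \<open>
  The minor of the inverse with rows \<open>i, k\<close> and columns \<open>j, l\<close>. The minors with \<open>i = k\<close> or \<open>j = l\<close>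
  vanish and may be left in sums over all indices.
\<close>

definition inv_minor :: "complex mat \<Rightarrow> nat \<Rightarrow> nat \<Rightarrow> nat \<Rightarrow> nat \<Rightarrow> complex" where
  "inv_minor N i k j l = inv_entry N i j * inv_entry N k l - inv_entry N i l * inv_entry N k j"

definition inv_minor_sum :: "nat \<Rightarrow> complex mat \<Rightarrow> real" where
  "inv_minor_sum n N = (\<Sum>i<n. \<Sum>k<n. \<Sum>j<n. \<Sum>l<n. (cmod (inv_minor N i k j l))\<^sup>2)"

lemma inv_entry_mult:
  assumes N: "N \<in> carrier_mat n n" and d: "det N \<noteq> 0" and ij: "i < n" "j < n"
  shows "(\<Sum>k<n. inv_entry N i k * N $$ (k,j)) = (if i = j then 1 else 0)"
    and "(\<Sum>k<n. N $$ (i,k) * inv_entry N k j) = (if i = j then 1 else 0)"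
proof -
  note a = adj_mat[OF N]
  have "(\<Sum>k<n. adj_mat N $$ (i,k) * N $$ (k,j)) = det N * (if i = j then 1 else 0)"
    using arg_cong[OF a(3), of "\<lambda>X. X $$ (i,j)"] ij N a(1) by (simp add: scalar_prod_def atLeast0LessThan)
  then show "(\<Sum>k<n. inv_entry N i k * N $$ (k,j)) = (if i = j then 1 else 0)"
    using d by (simp add: inv_entry_def flip: sum_divide_distrib)
  have "(\<Sum>k<n. N $$ (i,k) * adj_mat N $$ (k,j)) = det N * (if i = j then 1 else 0)"
    using arg_cong[OF a(2), of "\<lambda>X. X $$ (i,j)"] ij N a(1) by (simp add: scalar_prod_def atLeast0LessThan)
  then show "(\<Sum>k<n. N $$ (i,k) * inv_entry N k j) = (if i = j then 1 else 0)"
    using d by (simp add: inv_entry_def flip: sum_divide_distrib)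
qed

text \<open>
  The inverse of \<open>M - z\<close> is triangular on the same plane as \<open>M\<close>, with diagonal entries \<open>1 / (x - z)\<close> and
  \<open>1 / (y - z)\<close>.
\<close>

lemma inv_minor_sum_ge:
  assumes M: "M \<in> carrier_mat n n" and xy: "{#x, y#} \<subseteq># proots (char_poly M)"
    and d: "det (char_matrix M z) \<noteq> 0"
  shows "1 \<le> (cmod (x - z) * cmod (y - z))\<^sup>2 * inv_minor_sum n (char_matrix M z)"
proof -
  obtain p q :: "nat \<Rightarrow> complex" and c where
    p: "\<And>i. i < n \<Longrightarrow> (\<Sum>j<n. M $$ (i,j) * p j) = x * p i" and
    q: "\<And>i. i < n \<Longrightarrow> (\<Sum>j<n. M $$ (i,j) * q j) = y * q i + c * p i" and
    ind: "\<exists>i<n. p i \<noteq> 0" "\<And>c. \<exists>i<n. q i \<noteq> c * p i"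
    using triangular_pair_of_roots[OF M xy] by blast
  let ?N = "char_matrix M z" and ?a = "inv_entry (char_matrix M z)"
  have N: "?N \<in> carrier_mat n n" using M by simp
  have shift: "(\<Sum>j<n. ?N $$ (i,j) * f j) = (\<Sum>j<n. M $$ (i,j) * f j) - z * f i" if "i < n" for i f
  proof -
    have "?N $$ (i,j) = M $$ (i,j) - (if i = j then z else 0)" if "j < n" for j
      using M \<open>i < n\<close> that by (auto simp: char_matrix_def)
    then have "(\<Sum>j<n. ?N $$ (i,j) * f j) = (\<Sum>j<n. M $$ (i,j) * f j - (if i = j then z * f j else 0))"
      by (intro sum.cong refl) (simp add: left_diff_distrib)
    then show ?thesis using that by (simp add: sum_subtractf)
  qed
  have inv: "(\<Sum>j<n. ?a i j * (\<Sum>k<n. ?N $$ (j,k) * f k)) = f i" if "i < n" for i f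
  proof -
    have "(\<Sum>j<n. ?a i j * (\<Sum>k<n. ?N $$ (j,k) * f k)) = (\<Sum>k<n. (\<Sum>j<n. ?a i j * ?N $$ (j,k)) * f k)"
      by (simp add: sum_distrib_left sum_distrib_right mult_ac) (rule sum.swap)
    also have "\<dots> = (\<Sum>k<n. (if i = k then f k else 0))"
      using inv_entry_mult(1)[OF N d] that by (intro sum.cong) auto
    finally show ?thesis using that by simp
  qed
  have Np: "(\<Sum>j<n. ?N $$ (i,j) * p j) = (x - z) * p i" if "i < n" for i
    using shift[OF that] p[OF that] by (simp add: algebra_simps)
  have Nq: "(\<Sum>j<n. ?N $$ (i,j) * q j) = (y - z) * q i + c * p i" if "i < n" for i
    using shift[OF that] q[OF that] by (simp add: algebra_simps)
  have ap: "(x - z) * (\<Sum>j<n. ?a i j * p j) = p i" if "i < n" for i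
  proof -
    have "(x - z) * (\<Sum>j<n. ?a i j * p j) = (\<Sum>j<n. ?a i j * ((x - z) * p j))"
      by (simp add: sum_distrib_left mult_ac)
    also have "\<dots> = (\<Sum>j<n. ?a i j * (\<Sum>k<n. ?N $$ (j,k) * p k))" by (simp add: Np)
    finally show ?thesis using inv[OF that] by simp
  qed
  have x: "x - z \<noteq> 0" using ap ind(1) by force
  have ap': "(\<Sum>j<n. ?a i j * p j) = 1 / (x - z) * p i" if "i < n" for i
    using ap[OF that] x by (simp add: field_simps)
  have aq: "(y - z) * (\<Sum>j<n. ?a i j * q j) = q i - c / (x - z) * p i" if "i < n" for i
  proof -
    have "(y - z) * (\<Sum>j<n. ?a i j * q j) + c * (\<Sum>j<n. ?a i j * p j) = (\<Sum>j<n. ?a i j * ((y - z) * q j + c * p j))"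
      by (simp only: sum_distrib_left sum.distrib distrib_left mult.left_commute)
    also have "\<dots> = (\<Sum>j<n. ?a i j * (\<Sum>k<n. ?N $$ (j,k) * q k))" by (simp add: Nq)
    also have "\<dots> = q i" by (rule inv[OF that])
    finally show ?thesis using ap'[OF that] by (simp add: algebra_simps)
  qed
  have y: "y - z \<noteq> 0" using aq ind(2)[of "c / (x - z)"] by force
  have aq': "(\<Sum>j<n. ?a i j * q j) = 1 / (y - z) * q i + (- c / ((x - z) * (y - z))) * p i" if "i < n" for i
  proof -
    have "(\<Sum>j<n. ?a i j * q j) = (q i - c / (x - z) * p i) / (y - z)"
      using aq[OF that] y by (simp add: eq_divide_eq mult.commute)
    then show ?thesis by (simp add: diff_divide_distrib)
  qed
  have "(cmod (1 / (x - z) * (1 / (y - z))))\<^sup>2 \<le> inv_minor_sum n ?N"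
    unfolding inv_minor_sum_def inv_minor_def by (rule compound_norm_ge_triangular[OF ap' aq' ind])
  then have "1 / (cmod (x - z) * cmod (y - z))\<^sup>2 \<le> inv_minor_sum n ?N"
    by (simp add: norm_mult norm_divide power_divide)
  then show ?thesis using x y by (simp add: field_simps)
qed

lemma det2_mult:
  fixes a :: "'a :: comm_ring_1"
  assumes "e11 * a11 + e12 * a21 = 1" "e11 * a12 + e12 * a22 = 0"
    "e21 * a11 + e22 * a21 = 0" "e21 * a12 + e22 * a22 = (1 :: 'a)"
  shows "(e11 * e22 - e12 * e21) * (a11 * a22 - a12 * a21) = 1"
proof -
  have "(e11 * e22 - e12 * e21) * (a11 * a22 - a12 * a21) =
    (e11 * a11 + e12 * a21) * (e21 * a12 + e22 * a22) - (e11 * a12 + e12 * a22) * (e21 * a11 + e22 * a21)"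
    by (simp add: algebra_simps)
  then show ?thesis using assms by simp
qed

text \<open>
  One column of the resolvent identity \<open>a - b = b h a\<close> restricted to two rows, multiplied by the adjugate
  of the \<open>2 \<times> 2\<close> matrix \<open>b\<close>.
\<close>

lemma resolvent2:
  fixes x :: "'a :: comm_ring_1"
  assumes "x - p1 = b11 * (h11 * x + h12 * y) + b12 * (h21 * x + h22 * y)"
    and "y - p2 = b21 * (h11 * x + h12 * y) + b22 * (h21 * x + h22 * y)"
    and D: "D = b11 * b22 - b12 * b21"
  shows "(b22 - D * h11) * x + (- b12 - D * h12) * y = b22 * p1 - b12 * p2"
    and "(- b21 - D * h21) * x + (b11 - D * h22) * y = b11 * p2 - b21 * p1"
proof -
  define U where "U = h11 * x + h12 * y"
  define V where "V = h21 * x + h22 * y"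
  have x: "x = p1 + b11 * U + b12 * V" and y: "y = p2 + b21 * U + b22 * V"
    using assms by (simp_all add: U_def V_def algebra_simps)
  have "(b22 - D * h11) * x + (- b12 - D * h12) * y = b22 * x - b12 * y - D * U"
    by (simp add: U_def algebra_simps)
  also have "\<dots> = b22 * p1 - b12 * p2" unfolding D by (subst x, subst y) (simp add: algebra_simps)
  finally show "(b22 - D * h11) * x + (- b12 - D * h12) * y = b22 * p1 - b12 * p2" .
  have "(- b21 - D * h21) * x + (b11 - D * h22) * y = b11 * y - b21 * x - D * V"
    by (simp add: V_def algebra_simps)
  also have "\<dots> = b11 * p2 - b21 * p1" unfolding D by (subst x, subst y) (simp add: algebra_simps)
  finally show "(- b21 - D * h21) * x + (b11 - D * h22) * y = b11 * p2 - b21 * p1" .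
qed

text \<open>
  If two invertible matrices \<open>N\<close> and \<open>N'\<close> differ only in the block with rows \<open>j, l\<close> and columns \<open>i, k\<close>,
  then the resolvent identity for their inverses \<open>a\<close> and \<open>b\<close> closes on the opposite block: with \<open>\<alpha>, \<beta>\<close>
  the blocks of \<open>a, b\<close> with rows \<open>i, k\<close> and columns \<open>j, l\<close>, it reads \<open>\<alpha> - \<beta> = \<beta> (N' - N) \<alpha>\<close>. If \<open>\<beta>\<close> is invertible,
  \<open>(N - S) \<alpha> = 1\<close> for \<open>S = N' - \<beta>\<^sup>-\<^sup>1\<close>, which depends on the reference matrix \<open>N'\<close> only. If no
  reference matrix with invertible \<open>\<beta>\<close> exists, the minor vanishes on the whole slice.
\<close>

lemma inv_minor_block_slice:
  assumes ik: "i < n" "k < n" "i \<noteq> k" and jl: "j < n" "l < n" "j \<noteq> l"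
  shows "\<exists>s1 s2 s3 s4. \<forall>N. N \<in> carrier_mat n n \<and> det N \<noteq> 0 \<and>
     (\<forall>r<n. \<forall>c<n. \<not> (r \<in> {j,l} \<and> c \<in> {i,k}) \<longrightarrow> N $$ (r,c) = N0 $$ (r,c)) \<and> inv_minor N i k j l \<noteq> 0 \<longrightarrow>
     ((N $$ (j,i) - s1) * (N $$ (l,k) - s4) - (N $$ (j,k) - s2) * (N $$ (l,i) - s3)) * inv_minor N i k j l = 1"
    (is "\<exists>s1 s2 s3 s4. \<forall>N. ?good N \<longrightarrow> _")
proof (cases "\<exists>N. ?good N")
  case False
  then show ?thesis by blast
next
  case True
  then obtain N' where N': "?good N'" by blast
  let ?b = "inv_entry N'"
  define \<Delta> where "\<Delta> = inv_minor N' i k j l"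
  have \<Delta>: "\<Delta> = ?b i j * ?b k l - ?b i l * ?b k j" "\<Delta> \<noteq> 0" using N' by (auto simp: \<Delta>_def inv_minor_def)
  \<comment> \<open>the entries of the matrix S, with the inverse of the block of b written out\<close>
  define s1 s2 s3 s4 where s: "s1 = N' $$ (j,i) - ?b k l / \<Delta>" "s2 = N' $$ (j,k) + ?b i l / \<Delta>"
    "s3 = N' $$ (l,i) + ?b k j / \<Delta>" "s4 = N' $$ (l,k) - ?b i j / \<Delta>"
  have "((N $$ (j,i) - s1) * (N $$ (l,k) - s4) - (N $$ (j,k) - s2) * (N $$ (l,i) - s3)) * inv_minor N i k j l = 1"
    if N: "?good N" for N
  proof -
    let ?a = "inv_entry N"
    let ?h = "\<lambda>r c. N' $$ (r,c) - N $$ (r,c)"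
    have res: "?a p q - ?b p q = ?b p j * (?h j i * ?a i q + ?h j k * ?a k q) + ?b p l * (?h l i * ?a i q + ?h l k * ?a k q)"
      if pq: "p < n" "q < n" for p q
    proof -
      have h: "?h r c = 0" if "r < n" "c < n" "\<not> (r \<in> {j,l} \<and> c \<in> {i,k})" for r c
      proof -
        from N that have "N $$ (r,c) = N0 $$ (r,c)" by blast
        moreover from N' that have "N' $$ (r,c) = N0 $$ (r,c)" by blast
        ultimately show ?thesis by simp
      qed
      have 1: "(\<Sum>c<n. ?h r c * ?a c q) = (\<Sum>c\<in>{i,k}. ?h r c * ?a c q)" if "r < n" for r
        using ik h that by (intro sum.mono_neutral_right) auto
      have 2: "(\<Sum>r<n. ?b p r * (\<Sum>c<n. ?h r c * ?a c q)) = (\<Sum>r\<in>{j,l}. ?b p r * (\<Sum>c<n. ?h r c * ?a c q))"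
        using jl h by (intro sum.mono_neutral_right) (auto intro!: sum.neutral)
      have "(\<Sum>r<n. ?b p r * (\<Sum>c<n. ?h r c * ?a c q)) =
        (\<Sum>r<n. ?b p r * (\<Sum>c<n. N' $$ (r,c) * ?a c q)) - (\<Sum>r<n. ?b p r * (\<Sum>c<n. N $$ (r,c) * ?a c q))"
        by (simp add: algebra_simps sum_subtractf)
      also have "(\<Sum>r<n. ?b p r * (\<Sum>c<n. N' $$ (r,c) * ?a c q)) = (\<Sum>c<n. (\<Sum>r<n. ?b p r * N' $$ (r,c)) * ?a c q)"
        by (simp add: sum_distrib_left sum_distrib_right mult_ac) (rule sum.swap)
      also have "\<dots> = (\<Sum>c<n. (if p = c then ?a c q else 0))"
        using inv_entry_mult(1)[of N' n p] N' pq by (intro sum.cong) auto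
      also have "\<dots> = ?a p q" using pq by simp
      also have "(\<Sum>r<n. ?b p r * (\<Sum>c<n. N $$ (r,c) * ?a c q)) = (\<Sum>r<n. (if r = q then ?b p r else 0))"
        using inv_entry_mult(2)[of N n _ q] N pq by (intro sum.cong) auto
      also have "\<dots> = ?b p q" using pq by simp
      finally show ?thesis using ik jl unfolding 2 by (simp add: 1)
    qed
    have "((N $$ (j,i) - s1) * (N $$ (l,k) - s4) - (N $$ (j,k) - s2) * (N $$ (l,i) - s3)) * (?a i j * ?a k l - ?a i l * ?a k j) = 1"
    proof (rule det2_mult)
      \<comment> \<open>multiplying by \<open>\<Delta>\<close> clears the denominators in the s\<close>
      have e: "(g1 * u + g2 * v = w) \<longleftrightarrow> \<Delta> * (g1 * u + g2 * v) = \<Delta> * w" for g1 g2 u v w using \<Delta>(2) by simp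
      have s': "\<Delta> * (N $$ (j,i) - s1) = ?b k l - \<Delta> * ?h j i" "\<Delta> * (N $$ (j,k) - s2) = - ?b i l - \<Delta> * ?h j k"
        "\<Delta> * (N $$ (l,i) - s3) = - ?b k j - \<Delta> * ?h l i" "\<Delta> * (N $$ (l,k) - s4) = ?b i j - \<Delta> * ?h l k"
        using \<Delta>(2) unfolding s by (simp_all add: field_simps)
      note r1 = resolvent2[OF res[OF ik(1) jl(1)] res[OF ik(2) jl(1)] \<Delta>(1)]
      note r2 = resolvent2[OF res[OF ik(1) jl(2)] res[OF ik(2) jl(2)] \<Delta>(1)]
      show "(N $$ (j,i) - s1) * ?a i j + (N $$ (j,k) - s2) * ?a k j = 1"
        unfolding e unfolding distrib_left mult.assoc[symmetric] s' r1 by (simp add: \<Delta>(1) mult.commute)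
      show "(N $$ (j,i) - s1) * ?a i l + (N $$ (j,k) - s2) * ?a k l = 0"
        unfolding e unfolding distrib_left mult.assoc[symmetric] s' r2 by (simp add: mult.commute)
      show "(N $$ (l,i) - s3) * ?a i j + (N $$ (l,k) - s4) * ?a k j = 0"
        unfolding e unfolding distrib_left mult.assoc[symmetric] s' r1 by (simp add: mult.commute)
      show "(N $$ (l,i) - s3) * ?a i l + (N $$ (l,k) - s4) * ?a k l = 1"
        unfolding e unfolding distrib_left mult.assoc[symmetric] s' r2 by (simp add: \<Delta>(1) mult.commute)
    qed
    then show ?thesis by (simp add: inv_minor_def)
  qed
  then show ?thesis by blast
qed

section \<open>Random minors and measurability\<close>

lemma borel_measurable_det:
  fixes M :: "'a \<Rightarrow> complex mat"
  assumes M: "\<And>x. M x \<in> carrier_mat n n"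
    and [measurable]: "\<And>i j. i < n \<Longrightarrow> j < n \<Longrightarrow> (\<lambda>x. M x $$ (i,j)) \<in> borel_measurable L"
  shows "(\<lambda>x. det (M x)) \<in> borel_measurable L"
proof -
  have "(\<lambda>x. \<Sum>p | p permutes {0..<n}. signof p * (\<Prod>i = 0..<n. M x $$ (i, p i))) \<in> borel_measurable L"
  proof (intro borel_measurable_sum borel_measurable_times borel_measurable_const borel_measurable_prod)
    fix p i assume "p \<in> {p. p permutes {0..<n}}" "i \<in> {0..<n}"
    then have "i < n" "p i < n" using permutes_in_image[of p "{0..<n}" i] by auto
    then show "(\<lambda>x. M x $$ (i, p i)) \<in> borel_measurable L" by measurable
  qed
  then show ?thesis by (simp add: det_def'[OF M])
qed

lemma borel_measurable_inv_minor:
  fixes M :: "'a \<Rightarrow> complex mat"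
  assumes M: "\<And>x. M x \<in> carrier_mat n n"
    and m: "\<And>i j. i < n \<Longrightarrow> j < n \<Longrightarrow> (\<lambda>x. M x $$ (i,j)) \<in> borel_measurable L"
    and "i < n" "k < n" "j < n" "l < n"
  shows "(\<lambda>x. inv_minor (M x) i k j l) \<in> borel_measurable L"
proof -
  have "(\<lambda>x. inv_entry (M x) p q) \<in> borel_measurable L" if pq: "p < n" "q < n" for p q
  proof -
    have dims: "dim_row (M x) = n" "dim_col (M x) = n" for x using M[of x] by auto
    have "(\<lambda>x. det (mat_delete (M x) q p)) \<in> borel_measurable L"
    proof (rule borel_measurable_det[where n = "n - 1"])
      show "mat_delete (M x) q p \<in> carrier_mat (n - 1) (n - 1)" for x
        using mat_delete_carrier[OF M] .
      fix i j assume "i < n - 1" "j < n - 1"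
      then show "(\<lambda>x. mat_delete (M x) q p $$ (i,j)) \<in> borel_measurable L"
        using pq by (auto simp: mat_delete_def dims intro!: m)
    qed
    moreover have "inv_entry (M x) p q = (-1) ^ (q + p) * det (mat_delete (M x) q p) / det (M x)" for x
      using pq by (simp add: inv_entry_def adj_mat_def dims cofactor_def)
    ultimately show ?thesis using borel_measurable_det[OF M m] by simp
  qed
  then show ?thesis unfolding inv_minor_def using assms by measurable
qed

text \<open>
  With \<open>\<epsilon> = \<delta> / sqrt n\<close> and \<open>y\<close> the entries of \<open>sqrt n * G\<close> this is \<open>A + \<delta> G\<close>, as a function of
  coordinates whose joint law is a product.
\<close>

definition affine_mat :: "nat \<Rightarrow> complex mat \<Rightarrow> complex \<Rightarrow> (nat \<times> nat \<Rightarrow> complex) \<Rightarrow> complex mat" where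
  "affine_mat n A \<epsilon> y = mat n n (\<lambda>ij. A $$ ij + \<epsilon> * y ij)"

lemma affine_mat_carrier [simp]: "affine_mat n A \<epsilon> y \<in> carrier_mat n n"
  by (simp add: affine_mat_def)

lemma char_matrix_affine_mat:
  assumes "r < n" "c < n"
  shows "char_matrix (affine_mat n A \<epsilon> y) z $$ (r,c) = A $$ (r,c) + \<epsilon> * y (r,c) - (if r = c then z else 0)"
  using assms by (simp add: char_matrix_def affine_mat_def)

text \<open>
  On each slice a nonzero minor times \<open>\<epsilon>\<^sup>2\<close> times a shifted determinant of the four block coordinates is \<open>1\<close>, so a
  large minor forces a small determinant.
\<close>

lemma (in spread_law) prob_inv_minor_ge:
  assumes ik: "i < n" "k < n" and jl: "j < n" "l < n" and \<epsilon>: "\<epsilon> \<noteq> 0" and u: "0 < u"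
  defines "I \<equiv> {..<n} \<times> {..<n}"
  shows "measure (Pi\<^sub>M I (\<lambda>_. \<nu>)) {y \<in> space (Pi\<^sub>M I (\<lambda>_. \<nu>)).
       u \<le> (cmod (inv_minor (char_matrix (affine_mat n A \<epsilon> y) z) i k j l))\<^sup>2}
     \<le> \<kappa> * (1 + 2 * \<kappa>)\<^sup>2 / cmod \<epsilon> ^ 4 / u"
proof -
  let ?P = "Pi\<^sub>M I (\<lambda>_. \<nu>)"
  let ?N = "\<lambda>y. char_matrix (affine_mat n A \<epsilon> y) z"
  let ?Q = "{y \<in> space ?P. u \<le> (cmod (inv_minor (?N y) i k j l))\<^sup>2}"
  interpret P: product_prob_space "\<lambda>_. \<nu>" I ..
  have nonneg: "0 \<le> \<kappa> * (1 + 2 * \<kappa>)\<^sup>2 / cmod \<epsilon> ^ 4 / u" using kappa_nonneg u by simp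
  show ?thesis
  proof (cases "i = k \<or> j = l")
    case True
    then have "inv_minor (?N y) i k j l = 0" for y by (auto simp: inv_minor_def)
    then show ?thesis using u nonneg by simp
  next
    case False
    have Nc: "?N y \<in> carrier_mat n n" for y by simp
    have meas: "?Q \<in> sets ?P"
    proof -
      have "(\<lambda>y. ?N y $$ (r,c)) \<in> borel_measurable ?P" if "r < n" "c < n" for r c
      proof -
        have "(\<lambda>y. y (r,c)) \<in> borel_measurable ?P"
          using measurable_component_singleton[of "(r,c)" I "\<lambda>_. \<nu>"] that by (simp add: I_def)
        then show ?thesis using that by (simp add: char_matrix_affine_mat)
      qed
      then have "(\<lambda>y. inv_minor (?N y) i k j l) \<in> borel_measurable ?P"
        using ik jl by (intro borel_measurable_inv_minor[OF Nc])
      then show ?thesis by measurable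
    qed
    \<comment> \<open>the size of the determinant at which the minor has modulus \<open>sqrt u\<close>\<close>
    define r where "r = 1 / (cmod \<epsilon> ^ 2 * sqrt u)"
    have r0: "0 \<le> r" using u by (simp add: r_def)
    have "emeasure ?P ?Q \<le> ennreal (\<kappa> * (1 + 2 * \<kappa>)\<^sup>2 * r\<^sup>2)"
    proof (rule emeasure_PiM_det2_le[OF _ r0 _ _ meas, where ?p1.0 = "(j,i)" and ?p2.0 = "(j,k)" and ?p3.0 = "(l,i)" and ?p4.0 = "(l,k)"])
      show "finite I" "distinct [(j,i), (j,k), (l,i), (l,k)]" "{(j,i), (j,k), (l,i), (l,k)} \<subseteq> I"
        using ik jl False by (auto simp: I_def)
      fix y :: "nat \<times> nat \<Rightarrow> complex"
      obtain t1 t2 t3 t4 where t: "\<And>N. N \<in> carrier_mat n n \<Longrightarrow> det N \<noteq> 0 \<Longrightarrow>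
        (\<forall>r<n. \<forall>c<n. \<not> (r \<in> {j,l} \<and> c \<in> {i,k}) \<longrightarrow> N $$ (r,c) = ?N y $$ (r,c)) \<Longrightarrow> inv_minor N i k j l \<noteq> 0 \<Longrightarrow>
        ((N $$ (j,i) - t1) * (N $$ (l,k) - t4) - (N $$ (j,k) - t2) * (N $$ (l,i) - t3)) * inv_minor N i k j l = 1"
        using inv_minor_block_slice[OF ik _ jl, of "?N y"] False by blast
      define C where "C = (\<lambda>r c. A $$ (r,c) - (if r = c then z else 0))"
      show "\<exists>s1 s2 s3 s4. \<forall>a b c d. y((j,i) := a, (j,k) := b, (l,i) := c, (l,k) := d) \<in> ?Q \<longrightarrow>
          cmod ((a - s1) * (d - s4) - (b - s2) * (c - s3)) \<le> r"
      proof (rule exI[of _ "(t1 - C j i) / \<epsilon>"], rule exI[of _ "(t2 - C j k) / \<epsilon>"],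
          rule exI[of _ "(t3 - C l i) / \<epsilon>"], rule exI[of _ "(t4 - C l k) / \<epsilon>"], intro allI impI)
        fix a b c d
        let ?y = "y((j,i) := a, (j,k) := b, (l,i) := c, (l,k) := d)"
        let ?m = "inv_minor (?N ?y) i k j l"
        let ?e = "(a - (t1 - C j i) / \<epsilon>) * (d - (t4 - C l k) / \<epsilon>) - (b - (t2 - C j k) / \<epsilon>) * (c - (t3 - C l i) / \<epsilon>)"
        assume "?y \<in> ?Q"
        then have m: "u \<le> (cmod ?m)\<^sup>2" by simp
        then have m0: "?m \<noteq> 0" using u by auto
        then have d0: "det (?N ?y) \<noteq> 0" by (auto simp: inv_minor_def inv_entry_def)
        have agree: "\<forall>r<n. \<forall>c<n. \<not> (r \<in> {j,l} \<and> c \<in> {i,k}) \<longrightarrow> ?N ?y $$ (r,c) = ?N y $$ (r,c)"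
          by (auto simp: char_matrix_affine_mat)
        have sc: "C r c + \<epsilon> * v - w = \<epsilon> * (v - (w - C r c) / \<epsilon>)" for r c v w
          using \<epsilon> by (simp add: field_simps)
        have ent: "?N ?y $$ (j,i) = C j i + \<epsilon> * a" "?N ?y $$ (j,k) = C j k + \<epsilon> * b"
           "?N ?y $$ (l,i) = C l i + \<epsilon> * c" "?N ?y $$ (l,k) = C l k + \<epsilon> * d"
          using ik jl False by (auto simp: char_matrix_affine_mat C_def)
        have "\<epsilon>\<^sup>2 * ?e * ?m = 1"
          using t[OF Nc d0 agree m0] unfolding ent sc by (simp add: power2_eq_square algebra_simps)
        then have "cmod (\<epsilon>\<^sup>2 * ?e * ?m) = 1" by simp
        then have e1: "(cmod \<epsilon>)\<^sup>2 * cmod ?e * cmod ?m = 1" by (simp only: norm_mult norm_power)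
        have "sqrt u \<le> cmod ?m" using m by (rule real_le_lsqrt[OF _ _, rotated -1]) (use u in auto)
        then have "(cmod \<epsilon>)\<^sup>2 * cmod ?e * sqrt u \<le> (cmod \<epsilon>)\<^sup>2 * cmod ?e * cmod ?m"
          by (intro mult_left_mono) auto
        then have "cmod ?e * ((cmod \<epsilon>)\<^sup>2 * sqrt u) \<le> 1" using e1 by (simp add: mult_ac)
        then show "cmod ?e \<le> r" unfolding r_def using \<epsilon> u by (subst pos_le_divide_eq) auto
      qed
    qed
    then have "measure ?P ?Q \<le> \<kappa> * (1 + 2 * \<kappa>)\<^sup>2 * r\<^sup>2"
      using kappa_nonneg by (simp add: P.emeasure_eq_measure)
    also have "r\<^sup>2 = 1 / cmod \<epsilon> ^ 4 / u"
      using u by (simp add: r_def power_divide power_mult_distrib flip: power_mult)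
    finally show ?thesis by simp
  qed
qed

section \<open>Localisation of the eigenvalues\<close>

lemma l2_norm_mult_vec:
  assumes "A \<in> carrier_mat n n"
  shows "l2_norm (A *\<^sub>v Matrix.vec n f) = L2_set (\<lambda>i. cmod (\<Sum>j<n. A $$ (i,j) * f j)) {..<n}"
  using assms by (auto simp: l2_norm_def scalar_prod_def atLeast0LessThan intro!: L2_set_cong)

text \<open>
  The supremum that defines the operator norm is only meaningful once the values are known to be
  bounded; the sum of the moduli of all entries is a bound.
\<close>

lemma op_norm_upper:
  assumes A: "A \<in> carrier_mat n n" and f: "L2_set (\<lambda>i. cmod (f i)) {..<n} \<le> 1"
  shows "L2_set (\<lambda>i. cmod (\<Sum>j<n. A $$ (i,j) * f j)) {..<n} \<le> op_norm A"
proof -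
  have "l2_norm (A *\<^sub>v Matrix.vec n f) \<le> op_norm A"
    unfolding op_norm_def
  proof (rule cSUP_upper)
    show "Matrix.vec n f \<in> {v \<in> carrier_vec (dim_col A). l2_norm v \<le> 1}"
    proof -
      have "l2_norm (Matrix.vec n f) = L2_set (\<lambda>i. cmod (f i)) {..<n}"
        unfolding l2_norm_def by (intro L2_set_cong) auto
      then show ?thesis using f A by simp
    qed
    show "bdd_above ((\<lambda>v. l2_norm (A *\<^sub>v v)) ` {v \<in> carrier_vec (dim_col A). l2_norm v \<le> 1})"
    proof (rule bdd_aboveI2)
      fix v assume "v \<in> {v \<in> carrier_vec (dim_col A). l2_norm v \<le> 1}"
      then have v: "v \<in> carrier_vec n" "l2_norm v \<le> 1" using A by auto
      have v1: "cmod (vec_index v j) \<le> 1" if "j < n" for j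
      proof -
        have "cmod (vec_index v j) \<le> l2_norm v" unfolding l2_norm_def
          using that v by (intro member_le_L2_set) auto
        then show ?thesis using v by linarith
      qed
      have "v = Matrix.vec n (vec_index v)" using v by auto
      then have "l2_norm (A *\<^sub>v v) = L2_set (\<lambda>i. cmod (\<Sum>j<n. A $$ (i,j) * vec_index v j)) {..<n}"
        using l2_norm_mult_vec[OF A] by metis
      also have "\<dots> \<le> (\<Sum>i<n. cmod (\<Sum>j<n. A $$ (i,j) * vec_index v j))"
        by (rule L2_set_le_sum) simp
      also have "\<dots> \<le> (\<Sum>i<n. \<Sum>j<n. cmod (A $$ (i,j)) * 1)"
        using v1 by (intro sum_mono order.trans[OF norm_sum]) (auto simp: norm_mult intro!: mult_left_le)
      finally show "l2_norm (A *\<^sub>v v) \<le> (\<Sum>i<n. \<Sum>j<n. cmod (A $$ (i,j)) * 1)" .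
    qed
  qed
  then show ?thesis by (simp add: l2_norm_mult_vec[OF A])
qed

lemma root_cmod_le:
  assumes A: "A \<in> carrier_mat n n" and G: "G \<in> carrier_mat n n" and \<delta>: "0 \<le> \<delta>"
    and xy: "{#x, y#} \<subseteq># proots (char_poly (A + complex_of_real \<delta> \<cdot>\<^sub>m G))"
  shows "cmod x \<le> op_norm A + \<delta> * op_norm G"
proof -
  let ?M = "A + complex_of_real \<delta> \<cdot>\<^sub>m G"
  have M: "?M \<in> carrier_mat n n" using A G by simp
  obtain p where p: "\<forall>i<n. (\<Sum>j<n. ?M $$ (i,j) * p j) = x * p i" "\<exists>i<n. p i \<noteq> 0"
    using triangular_pair_of_roots[OF M xy] by blast
  let ?L = "\<lambda>f. L2_set (\<lambda>i. cmod (f i)) {..<n}"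
  have scale: "?L (\<lambda>i. c * f i) = cmod c * ?L f" for c f
    by (simp add: norm_mult L2_set_right_distrib)
  have "?L p \<noteq> 0" using p(2) by (auto simp: L2_set_eq_0_iff)
  then have L: "?L p > 0" by (simp add: L2_set_nonneg order_less_le)
  define f where "f = (\<lambda>i. of_real (1 / ?L p) * p i)"
  have f1: "?L f = 1" unfolding f_def scale using L by (simp add: norm_divide)
  have mf: "(\<Sum>j<n. A $$ (i,j) * f j) + of_real \<delta> * (\<Sum>j<n. G $$ (i,j) * f j) = x * f i" if "i < n" for i
  proof -
    have "(\<Sum>j<n. A $$ (i,j) * f j) + of_real \<delta> * (\<Sum>j<n. G $$ (i,j) * f j) = of_real (1 / ?L p) * (\<Sum>j<n. ?M $$ (i,j) * p j)"
      unfolding f_def sum_distrib_left sum.distrib[symmetric]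
      using that A G by (intro sum.cong refl) (simp add: algebra_simps)
    then show ?thesis using p(1) that by (simp add: f_def)
  qed
  have "cmod x = ?L (\<lambda>i. x * f i)" unfolding scale f1 by simp
  also have "\<dots> = ?L (\<lambda>i. (\<Sum>j<n. A $$ (i,j) * f j) + of_real \<delta> * (\<Sum>j<n. G $$ (i,j) * f j))"
    by (intro L2_set_cong) (simp_all add: mf)
  also have "\<dots> \<le> L2_set (\<lambda>i. cmod (\<Sum>j<n. A $$ (i,j) * f j) + cmod (of_real \<delta> * (\<Sum>j<n. G $$ (i,j) * f j))) {..<n}"
    by (intro L2_set_mono norm_triangle_ineq) auto
  also have "\<dots> \<le> ?L (\<lambda>i. \<Sum>j<n. A $$ (i,j) * f j) + ?L (\<lambda>i. of_real \<delta> * (\<Sum>j<n. G $$ (i,j) * f j))"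
    by (rule L2_set_triangle_ineq)
  also have "\<dots> \<le> op_norm A + \<delta> * op_norm G"
    unfolding scale using op_norm_upper[OF A, of f] op_norm_upper[OF G, of f] \<delta> f1
    by (intro add_mono) (auto intro: mult_left_mono)
  finally show ?thesis .
qed

lemma min_eigenvalue_gap_leE:
  assumes M: "M \<in> carrier_mat n n" and n: "2 \<le> n" and gap: "min_eigenvalue_gap M \<le> s"
  obtains x y where "{#x, y#} \<subseteq># proots (char_poly M)" "cmod (x - y) \<le> s"
proof -
  let ?R = "proots (char_poly M)"
  let ?S = "{cmod (x - y) | x y. {#x, y#} \<subseteq># ?R}"
  have "?S \<subseteq> (\<lambda>(x,y). cmod (x - y)) ` (set_mset ?R \<times> set_mset ?R)"
    by (auto simp: image_iff dest!: set_mset_mono)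
  then have fin: "finite ?S" by (rule finite_subset) auto
  have sz: "size ?R = n" using degree_monic_char_poly[OF M] by (simp add: size_proots_complex)
  then obtain x R' where R': "?R = add_mset x R'" using n by (metis size_eq_Suc_imp_eq_union Suc_le_D numeral_2_eq_2)
  then have "R' \<noteq> {#}" using sz n by auto
  then obtain y R'' where "R' = add_mset y R''" by (meson multiset_cases)
  then have "{#x, y#} \<subseteq># ?R" using R' by simp
  then have "?S \<noteq> {}" by blast
  from Min_in[OF fin this] obtain x y where "{#x, y#} \<subseteq># ?R" "min_eigenvalue_gap M = cmod (x - y)"
    unfolding min_eigenvalue_gap_def by auto
  then show ?thesis using gap that by simp
qed

lemma grid_point_near:
  assumes "0 < s" "cmod x \<le> R"
  shows "\<exists>p\<in>{-\<lceil>R / s\<rceil>..\<lceil>R / s\<rceil>}. \<exists>q\<in>{-\<lceil>R / s\<rceil>..\<lceil>R / s\<rceil>}. cmod (x - Complex (s * of_int p) (s * of_int q)) \<le> 2 * s"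
proof -
  have c: "\<lfloor>v / s\<rfloor> \<in> {-\<lceil>R / s\<rceil>..\<lceil>R / s\<rceil>}" "\<bar>v - s * of_int \<lfloor>v / s\<rfloor>\<bar> \<le> s" if "\<bar>v\<bar> \<le> R" for v
  proof -
    have "v / s \<le> R / s" "- (R / s) \<le> v / s"
      using that assms by (auto simp: field_simps abs_le_iff)
    then show "\<lfloor>v / s\<rfloor> \<in> {-\<lceil>R / s\<rceil>..\<lceil>R / s\<rceil>}" by (simp; linarith)
    have "s * of_int \<lfloor>v / s\<rfloor> \<le> s * (v / s)" "s * (v / s) \<le> s * (of_int \<lfloor>v / s\<rfloor> + 1)"
      using assms(1) by (intro mult_left_mono; linarith)+
    moreover have "s * (v / s) = v" using assms(1) by simp
    ultimately have "s * of_int \<lfloor>v / s\<rfloor> \<le> v" "v \<le> s * of_int \<lfloor>v / s\<rfloor> + s"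
      by (simp_all add: distrib_left)
    then show "\<bar>v - s * of_int \<lfloor>v / s\<rfloor>\<bar> \<le> s" using assms(1) by linarith
  qed
  have "\<bar>Re x\<bar> \<le> R" "\<bar>Im x\<bar> \<le> R" using assms abs_Re_le_cmod[of x] abs_Im_le_cmod[of x] by linarith+
  note c1 = c[OF this(1)] and c2 = c[OF this(2)]
  have "cmod (x - Complex (s * of_int \<lfloor>Re x / s\<rfloor>) (s * of_int \<lfloor>Im x / s\<rfloor>)) \<le> s + s"
    using c1(2) c2(2) by (intro order.trans[OF cmod_le] add_mono) simp_all
  then show ?thesis using c1(1) c2(1) by (intro bexI[of _ "\<lfloor>Re x / s\<rfloor>"] bexI[of _ "\<lfloor>Im x / s\<rfloor>"]) auto
qed

section \<open>Minors of the resolvent at a fixed point\<close>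

lemma borel_measurable_inv_minor_sum:
  fixes M :: "'a \<Rightarrow> complex mat"
  assumes "\<And>x. M x \<in> carrier_mat n n"
    and "\<And>i j. i < n \<Longrightarrow> j < n \<Longrightarrow> (\<lambda>x. M x $$ (i,j)) \<in> borel_measurable L"
  shows "(\<lambda>x. inv_minor_sum n (M x)) \<in> borel_measurable L"
  unfolding inv_minor_sum_def
proof (intro borel_measurable_sum borel_measurable_power)
  fix i k j l assume "i \<in> {..<n}" "k \<in> {..<n}" "j \<in> {..<n}" "l \<in> {..<n}"
  then have "(\<lambda>x. inv_minor (M x) i k j l) \<in> borel_measurable L"
    by (intro borel_measurable_inv_minor[OF assms]) auto
  then show "(\<lambda>x. cmod (inv_minor (M x) i k j l)) \<in> borel_measurable L" by simp
qed

lemma (in spread_law) borel_measurable_char_matrix_entry: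
  assumes "r < n" "c < n"
  shows "(\<lambda>y. char_matrix (affine_mat n A \<epsilon> y) z $$ (r,c)) \<in> borel_measurable (Pi\<^sub>M ({..<n} \<times> {..<n}) (\<lambda>_. \<nu>))"
proof -
  have "(\<lambda>y. y (r,c)) \<in> borel_measurable (Pi\<^sub>M ({..<n} \<times> {..<n}) (\<lambda>_. \<nu>))"
    using measurable_component_singleton[of "(r,c)" "{..<n} \<times> {..<n}" "\<lambda>_. \<nu>"] assms by simp
  then show ?thesis using assms by (simp add: char_matrix_affine_mat)
qed

lemma (in spread_law) prob_inv_minor_sum_ge:
  fixes n :: nat
  assumes \<epsilon>: "\<epsilon> \<noteq> 0" and t: "0 < t" "t \<le> 2 ^ m"
  defines "I \<equiv> {..<n} \<times> {..<n}"
  shows "measure (Pi\<^sub>M I (\<lambda>_. \<nu>)) {y \<in> space (Pi\<^sub>M I (\<lambda>_. \<nu>)).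
       t \<le> inv_minor_sum n (char_matrix (affine_mat n A \<epsilon> y) z)}
     \<le> real n ^ 4 * (1 + real m * (\<kappa> * (1 + 2 * \<kappa>)\<^sup>2 / cmod \<epsilon> ^ 4)) / t"
proof -
  let ?P = "Pi\<^sub>M I (\<lambda>_. \<nu>)"
  let ?N = "\<lambda>y. char_matrix (affine_mat n A \<epsilon> y) z"
  interpret P: product_prob_space "\<lambda>_. \<nu>" I ..
  let ?J = "{..<n} \<times> {..<n} \<times> {..<n} \<times> {..<n}"
  let ?X = "\<lambda>(i,k,j,l) y. (cmod (inv_minor (?N y) i k j l))\<^sup>2"
  have Nc: "?N y \<in> carrier_mat n n" for y by simp
  have "measure ?P {y \<in> space ?P. t \<le> (\<Sum>q\<in>?J. ?X q y)}
      \<le> real (card ?J) * (1 + real m * (\<kappa> * (1 + 2 * \<kappa>)\<^sup>2 / cmod \<epsilon> ^ 4)) / t"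
  proof (rule P.weak_L1_sum_tail[OF _ _ _ _ t])
    fix q assume "q \<in> ?J"
    then obtain i k j l where q: "q = (i,k,j,l)" "i < n" "k < n" "j < n" "l < n" by auto
    have "(\<lambda>y. inv_minor (?N y) i k j l) \<in> borel_measurable ?P"
      using q borel_measurable_char_matrix_entry unfolding I_def by (intro borel_measurable_inv_minor[OF Nc])
    then show "?X q \<in> borel_measurable ?P" unfolding q by simp
    fix u :: real assume "1 \<le> u"
    then show "measure ?P {y \<in> space ?P. u \<le> ?X q y} \<le> \<kappa> * (1 + 2 * \<kappa>)\<^sup>2 / cmod \<epsilon> ^ 4 / u"
      unfolding q using prob_inv_minor_ge[OF q(2-5) \<epsilon>, of u A z] by (simp add: I_def)
  qed auto
  then show ?thesis
    by (simp add: inv_minor_sum_def sum_quad card_cartesian_product power4_eq_xxxx)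
qed

text \<open>
  Independence identifies the joint law of the entries of \<open>sqrt n * G\<close> with a
  product of copies of the law of \<open>\<xi>\<close>. The constant \<open>324 = 4 * 9\<^sup>2\<close> comes from \<open>\<kappa> (1 + 2 \<kappa>)\<^sup>2\<close> with
  \<open>\<kappa> = pi K \<le> 4 K\<close> and \<open>1 \<le> K\<close>.
\<close>

lemma prob_iid_inv_minor_sum_ge:
  fixes z :: complex
  assumes P: "prob_space P" and dens: "has_continuous_density_bounded_by P \<xi> K" and K: "1 \<le> K"
    and iid: "iid_matrix P \<xi> n G" and n: "0 < n" and A: "A \<in> carrier_mat n n"
    and \<delta>: "0 < \<delta>" and t: "0 < t" "t \<le> 2 ^ m"
  defines "F \<equiv> {\<omega> \<in> space P. t \<le> inv_minor_sum n (char_matrix (A + complex_of_real \<delta> \<cdot>\<^sub>m G \<omega>) z)}"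
  shows "F \<in> sets P"
    and "measure P F \<le> real n ^ 4 * (1 + real m * (324 * K ^ 3 * (real n)\<^sup>2 / \<delta> ^ 4)) / t"
proof -
  interpret prob_space P by fact
  let ?I = "{..<n} \<times> {..<n}"
  let ?\<nu> = "distr P borel \<xi>"
  define X where "X = (\<lambda>ij \<omega>. complex_of_real (sqrt (real n)) * G \<omega> $$ ij)"
  define Y where "Y = (\<lambda>\<omega>. \<lambda>ij\<in>?I. X ij \<omega>)"
  define \<epsilon> where "\<epsilon> = complex_of_real (\<delta> / sqrt (real n))"
  have Gc: "\<And>\<omega>. \<omega> \<in> space P \<Longrightarrow> G \<omega> \<in> carrier_mat n n" and ind: "indep_vars (\<lambda>_. borel) X ?I"
    and law: "\<And>ij. ij \<in> ?I \<Longrightarrow> distr P borel (X ij) = ?\<nu>"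
    using iid unfolding iid_matrix_def X_def by auto
  interpret sl: spread_law ?\<nu> "pi * K"
    using bounded_density_imp_spread_law[OF P dens] K by simp
  have rv: "\<And>ij. ij \<in> ?I \<Longrightarrow> X ij \<in> borel_measurable P"
    using ind unfolding indep_vars_def by auto
  have Im: "?I \<noteq> {}" using n by auto
  have setsPi: "sets (Pi\<^sub>M ?I (\<lambda>_. ?\<nu>)) = sets (Pi\<^sub>M ?I (\<lambda>_. borel))"
    by (intro sets_PiM_cong) auto
  have "distr P (Pi\<^sub>M ?I (\<lambda>_. borel)) Y = Pi\<^sub>M ?I (\<lambda>ij. distr P borel (X ij))"
    using ind indep_vars_iff_distr_eq_PiM'[OF Im rv] by (simp add: Y_def)
  also have "\<dots> = Pi\<^sub>M ?I (\<lambda>_. ?\<nu>)" by (intro PiM_cong) (auto simp: law)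
  finally have dY: "distr P (Pi\<^sub>M ?I (\<lambda>_. borel)) Y = Pi\<^sub>M ?I (\<lambda>_. ?\<nu>)" .
  have Ym: "Y \<in> measurable P (Pi\<^sub>M ?I (\<lambda>_. borel))"
    unfolding Y_def by (intro measurable_restrict rv)
  define Q where "Q = {y \<in> space (Pi\<^sub>M ?I (\<lambda>_. ?\<nu>)). t \<le> inv_minor_sum n (char_matrix (affine_mat n A \<epsilon> y) z)}"
  have Qm: "Q \<in> sets (Pi\<^sub>M ?I (\<lambda>_. ?\<nu>))"
  proof -
    have [measurable]: "(\<lambda>y. inv_minor_sum n (char_matrix (affine_mat n A \<epsilon> y) z)) \<in> borel_measurable (Pi\<^sub>M ?I (\<lambda>_. ?\<nu>))"
      by (intro borel_measurable_inv_minor_sum sl.borel_measurable_char_matrix_entry) auto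
    show ?thesis unfolding Q_def by measurable
  qed
  have aff: "A + complex_of_real \<delta> \<cdot>\<^sub>m G \<omega> = affine_mat n A \<epsilon> (Y \<omega>)" if "\<omega> \<in> space P" for \<omega>
  proof (rule eq_matI)
    fix i j assume ij: "i < dim_row (affine_mat n A \<epsilon> (Y \<omega>))" "j < dim_col (affine_mat n A \<epsilon> (Y \<omega>))"
    have e: "complex_of_real \<delta> = \<epsilon> * complex_of_real (sqrt (real n))"
      unfolding \<epsilon>_def of_real_mult[symmetric] using n by simp
    show "(A + complex_of_real \<delta> \<cdot>\<^sub>m G \<omega>) $$ (i,j) = affine_mat n A \<epsilon> (Y \<omega>) $$ (i,j)"
      unfolding e using ij Gc[OF that] A by (simp add: affine_mat_def Y_def X_def mult.assoc)
  qed (use Gc[OF that] A in \<open>auto simp: affine_mat_def\<close>)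
  have sp: "Y \<omega> \<in> space (Pi\<^sub>M ?I (\<lambda>_. ?\<nu>))" for \<omega>
    by (auto simp: Y_def space_PiM)
  have FQ: "F = Y -` Q \<inter> space P"
    unfolding F_def Q_def using aff sp by auto
  have Qm': "Q \<in> sets (Pi\<^sub>M ?I (\<lambda>_. borel))" using Qm setsPi by simp
  show "F \<in> sets P" unfolding FQ by (rule measurable_sets[OF Ym Qm'])
  have "measure P F = measure (Pi\<^sub>M ?I (\<lambda>_. ?\<nu>)) Q"
    unfolding FQ by (simp add: measure_distr[OF Ym Qm'] flip: dY)
  also have "\<dots> \<le> real n ^ 4 * (1 + real m * (pi * K * (1 + 2 * (pi * K))\<^sup>2 / cmod \<epsilon> ^ 4)) / t"
    unfolding Q_def using \<delta> n by (intro sl.prob_inv_minor_sum_ge t) (auto simp: \<epsilon>_def)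
  also have "\<dots> \<le> real n ^ 4 * (1 + real m * (324 * K ^ 3 * (real n)\<^sup>2 / \<delta> ^ 4)) / t"
  proof -
    have "cmod \<epsilon> ^ 4 = \<delta> ^ 4 / (real n)\<^sup>2"
    proof -
      have "sqrt (real n) ^ 4 = (sqrt (real n) ^ 2) ^ 2" by (simp only: flip: power_mult) simp
      then have "sqrt (real n) ^ 4 = (real n)\<^sup>2" by simp
      then show ?thesis using \<delta> by (simp add: \<epsilon>_def power_divide norm_divide)
    qed
    then have e: "w / cmod \<epsilon> ^ 4 = w * (real n)\<^sup>2 / \<delta> ^ 4" for w by simp
    have "pi * K * (1 + 2 * (pi * K))\<^sup>2 \<le> 4 * K * (9 * K)\<^sup>2"
    proof (intro mult_mono power_mono)
      have "pi * K \<le> 4 * K" using K pi_less_4 by (intro mult_right_mono) auto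
      then show "1 + 2 * (pi * K) \<le> 9 * K" using K by linarith
    qed (use K pi_less_4 in auto)
    also have "\<dots> = 324 * K ^ 3" by (simp add: power2_eq_square power3_eq_cube)
    finally show ?thesis unfolding e using t \<delta>
      by (intro divide_right_mono mult_left_mono add_left_mono mult_right_mono) auto
  qed
  finally show "measure P F \<le> real n ^ 4 * (1 + real m * (324 * K ^ 3 * (real n)\<^sup>2 / \<delta> ^ 4)) / t" .
qed

text \<open>
  The radii for a pair at distance at most \<open>s\<close>: the nearest grid point is within \<open>2 s\<close> of \<open>x\<close>, hence
  within \<open>3 s\<close> of \<open>y\<close>, and the translation of the grid adds at most \<open>s\<close> to both.
\<close>

lemma inv_minor_sum_ge_of_close_roots:
  assumes M: "M \<in> carrier_mat n n" and xy: "{#x, y#} \<subseteq># proots (char_poly M)"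
    and d: "det (char_matrix M z) \<noteq> 0" and s: "0 < s" and xz: "cmod (x - z) \<le> 3 * s" and yz: "cmod (y - z) \<le> 4 * s"
  shows "1 / (144 * s ^ 4) \<le> inv_minor_sum n (char_matrix M z)"
proof -
  let ?S = "inv_minor_sum n (char_matrix M z)"
  have S: "0 \<le> ?S" unfolding inv_minor_sum_def by (intro sum_nonneg) auto
  have "1 \<le> (cmod (x - z) * cmod (y - z))\<^sup>2 * ?S"
    by (rule inv_minor_sum_ge[OF M xy d])
  also have "\<dots> \<le> ((3 * s) * (4 * s))\<^sup>2 * ?S"
    using xz yz s S by (intro mult_right_mono power_mono mult_mono) auto
  also have "((3 * s) * (4 * s))\<^sup>2 = 144 * s ^ 4" by (simp add: power2_eq_square power4_eq_xxxx)
  finally show ?thesis using s by (simp add: field_simps)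
qed

lemma (in finite_measure) measure_liminf_le:
  assumes F: "\<And>k. F k \<in> sets M" and p: "\<And>k. measure M (F k) \<le> p"
  shows "measure M (\<Union>m::nat. \<Inter>k\<in>{m..}. F k) \<le> p"
proof -
  let ?A = "\<lambda>m. \<Inter>k\<in>{m..}. F k"
  have A: "range ?A \<subseteq> sets M" using F by auto
  have "incseq ?A" by (force simp: incseq_def)
  then have lim: "(\<lambda>m. measure M (?A m)) \<longlonglongrightarrow> measure M (\<Union>m. ?A m)"
    by (rule finite_Lim_measure_incseq[OF A])
  have "measure M (?A m) \<le> p" for m
    using F by (intro order.trans[OF finite_measure_mono p[of m]]) auto
  then show ?thesis by (intro LIMSEQ_le_const2[OF lim]) auto
qed

section \<open>The gap estimate\<close>

theorem theoremB2:
  shows "\<exists>c::real. c > 0 \<and>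
    (\<forall>(P :: 'a measure) (\<xi> :: 'a \<Rightarrow> complex) (K::real) (n::nat) (G :: 'a \<Rightarrow> complex mat)
       (A :: complex mat) (\<delta>::real) (K'::real) (s::real).
      prob_space P \<and>
      sub_gaussian P \<xi> \<and>
      has_continuous_density_bounded_by P \<xi> K \<and> K \<ge> 1 \<and>
      n \<ge> 2 \<and>
      iid_matrix P \<xi> n G \<and>
      A \<in> carrier_mat n n \<and> op_norm A \<le> 1 \<and>
      0 < \<delta> \<and> \<delta> < 1 \<and>
      K' \<ge> 0 \<and>
      0 < s \<and> s \<le> 1
      \<longrightarrow>
      measure P {\<omega> \<in> space P. op_norm (G \<omega>) \<le> K' \<and>
                   min_eigenvalue_gap (A + complex_of_real \<delta> \<cdot>\<^sub>m G \<omega>) \<le> s}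
        \<le> c * log 2 (2 * (1 + \<delta> * K') / s) * (1 + \<delta> * K')\<^sup>2 * K ^ 4 * real n ^ 6 * (s\<^sup>2 / \<delta> ^ 4))"
  \<comment> \<open>\<open>4665600 = 25 * 144 * 4 * 324\<close>: the number of grid points, the level \<open>t\<close>, the number of dyadic levels,
    and the constant of the density bound\<close>
proof (rule exI[of _ 4665600], intro conjI allI impI, goal_cases)
  case 1
  show ?case by simp
next
  case (2 P \<xi> K n G A \<delta> K' s)
  then have P: "prob_space P" and dens: "has_continuous_density_bounded_by P \<xi> K" and K: "1 \<le> K"
    and n: "2 \<le> n" and iid: "iid_matrix P \<xi> n G" and A: "A \<in> carrier_mat n n" "op_norm A \<le> 1"
    and \<delta>: "0 < \<delta>" "\<delta> < 1" and K': "0 \<le> K'" and s: "0 < s" "s \<le> 1" by auto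
  interpret prob_space P by fact
  let ?M = "\<lambda>\<omega>. A + complex_of_real \<delta> \<cdot>\<^sub>m G \<omega>"
  have Gc: "G \<omega> \<in> carrier_mat n n" if "\<omega> \<in> space P" for \<omega> using iid that by (simp add: iid_matrix_def)
  have Mc: "?M \<omega> \<in> carrier_mat n n" if "\<omega> \<in> space P" for \<omega> using Gc[OF that] A by simp
  define R where "R = 1 + \<delta> * K'"
  have R: "1 \<le> R" using \<delta> K' by (simp add: R_def)
  define t where "t = 1 / (144 * s ^ 4)"
  \<comment> \<open>the number of dyadic levels up to \<open>1 / s ^ 4\<close>\<close>
  define m where "m = nat \<lceil>4 * log 2 (1 / s)\<rceil>"
  define L where "L = log 2 (2 * R / s)"
  define g where "g = {- \<lceil>R / s\<rceil>..\<lceil>R / s\<rceil>}"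
  define node where "node = (\<lambda>(k::nat) (p,q). Complex (s * of_int p) (s * of_int q) + of_real (s / (real k + 1)))"
  define H where "H = (\<lambda>z. {\<omega> \<in> space P. t \<le> inv_minor_sum n (char_matrix (?M \<omega>) z)})"
  define F where "F = (\<lambda>k. \<Union>pq\<in>g \<times> g. H (node k pq))"
  define b where "b = real n ^ 4 * (1 + real m * (324 * K ^ 3 * (real n)\<^sup>2 / \<delta> ^ 4)) / t"
  have t0: "0 < t" using s by (simp add: t_def)
  have log0: "0 \<le> log 2 (1 / s)" using s by simp
  have tm: "t \<le> 2 ^ m"
  proof -
    have "t \<le> (1 / s) ^ 4" using s by (simp add: t_def field_simps)
    also have "(1 / s) ^ 4 = 2 powr (4 * log 2 (1 / s))"
    proof -
      have "2 powr (4 * log 2 (1 / s)) = (2 powr log 2 (1 / s)) powr 4" by (simp add: powr_powr mult.commute)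
      also have "\<dots> = (1 / s) powr 4" using s by simp
      also have "\<dots> = (1 / s) ^ 4" using s powr_realpow[of "1 / s" 4] by simp
      finally show ?thesis ..
    qed
    also have "\<dots> \<le> 2 powr real m" unfolding m_def by (intro powr_mono real_nat_ceiling_ge) auto
    also have "\<dots> = 2 ^ m" by (simp add: powr_realpow)
    finally show ?thesis .
  qed
  have Hm: "H z \<in> sets P" and Hp: "prob (H z) \<le> b" for z
    using prob_iid_inv_minor_sum_ge[OF P dens K iid _ A(1) \<delta>(1) t0 tm, of z] n by (auto simp: H_def b_def)
  have Fm: "F k \<in> sets P" for k unfolding F_def using Hm by (intro sets.finite_UN) (auto simp: g_def)
  have cg: "real (card (g \<times> g)) \<le> 25 * R\<^sup>2 / s\<^sup>2"
  proof -
    have rs: "1 \<le> R / s" using R s by (simp add: field_simps)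
    have c0: "0 \<le> \<lceil>R / s\<rceil>" "of_int \<lceil>R / s\<rceil> \<le> R / s + 1" using rs by linarith+
    have "real (card g) = 2 * of_int \<lceil>R / s\<rceil> + 1" using c0(1) by (simp add: g_def)
    also have "\<dots> \<le> 5 * (R / s)" using c0(2) rs by linarith
    finally have "real (card g) \<le> 5 * (R / s)" .
    then have "real (card g) * real (card g) \<le> (5 * (R / s)) * (5 * (R / s))" by (intro mult_mono) auto
    then show ?thesis by (simp add: card_cartesian_product power2_eq_square)
  qed
  have b0: "0 \<le> b" using Hp[of 0] measure_nonneg[of P "H 0"] by linarith
  have Fp: "prob (F k) \<le> 25 * R\<^sup>2 / s\<^sup>2 * b" for k
  proof -
    have "prob (F k) \<le> (\<Sum>pq\<in>g \<times> g. prob (H (node k pq)))"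
      unfolding F_def using Hm by (intro finite_measure_subadditive_finite) (auto simp: g_def)
    also have "\<dots> \<le> real (card (g \<times> g)) * b" using Hp by (intro sum_bounded_above)
    also have "\<dots> \<le> 25 * R\<^sup>2 / s\<^sup>2 * b" by (intro mult_right_mono cg b0)
    finally show ?thesis .
  qed
  let ?E = "{\<omega> \<in> space P. op_norm (G \<omega>) \<le> K' \<and> min_eigenvalue_gap (?M \<omega>) \<le> s}"
  have sub: "?E \<subseteq> (\<Union>m. \<Inter>k\<in>{m..}. F k)"
  proof
    fix \<omega> assume "\<omega> \<in> ?E"
    then have \<omega>: "\<omega> \<in> space P" "op_norm (G \<omega>) \<le> K'" "min_eigenvalue_gap (?M \<omega>) \<le> s" by auto
    obtain x y where xy: "{#x, y#} \<subseteq># proots (char_poly (?M \<omega>))" "cmod (x - y) \<le> s"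
      using min_eigenvalue_gap_leE[OF Mc[OF \<omega>(1)] n \<omega>(3)] .
    have "cmod x \<le> op_norm A + \<delta> * op_norm (G \<omega>)"
      using root_cmod_le[OF A(1) Gc[OF \<omega>(1)] _ xy(1)] \<delta> by simp
    also have "\<dots> \<le> R" unfolding R_def using A \<omega> \<delta> by (intro add_mono mult_left_mono) auto
    finally obtain p q where pq: "p \<in> g" "q \<in> g"
      and near: "cmod (x - Complex (s * of_int p) (s * of_int q)) \<le> 2 * s"
      using grid_point_near[OF s(1), of x R] unfolding g_def by blast
    define z where "z = (\<lambda>k. node k (p,q))"
    have xz: "cmod (x - z k) \<le> 3 * s" for k
    proof -
      have "x - z k = (x - Complex (s * of_int p) (s * of_int q)) - of_real (s / (real k + 1))"
        by (simp add: z_def node_def)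
      then have "cmod (x - z k) \<le> cmod (x - Complex (s * of_int p) (s * of_int q)) + cmod (of_real (s / (real k + 1)))"
        by (metis norm_triangle_ineq4)
      moreover have "cmod (of_real (s / (real k + 1))) \<le> s"
        unfolding norm_of_real using s by (simp add: field_simps)
      ultimately show ?thesis using near by linarith
    qed
    have yz: "cmod (y - z k) \<le> 4 * s" for k
    proof -
      have "cmod (y - z k) \<le> cmod (x - z k) + cmod (x - y)"
        using norm_triangle_ineq4[of "x - z k" "x - y"] by simp
      then show ?thesis using xz[of k] xy(2) by linarith
    qed
    let ?Z = "{w. poly (char_poly (?M \<omega>)) w = 0}"
    have "char_poly (?M \<omega>) \<noteq> 0" using degree_monic_char_poly[OF Mc[OF \<omega>(1)]] by auto
    then have "finite ?Z" by (rule poly_roots_finite)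
    moreover have "inj z" by (rule injI) (use s in \<open>simp add: z_def node_def field_simps\<close>)
    ultimately have "finite (z -` ?Z)" by (rule finite_vimageI)
    \<comment> \<open>beyond this index the translated grid point avoids the spectrum\<close>
    then obtain m where m: "\<And>k. k \<in> z -` ?Z \<Longrightarrow> k < m"
      unfolding finite_nat_set_iff_bounded by blast
    have "\<omega> \<in> F k" if "m \<le> k" for k
    proof -
      have "poly (char_poly (?M \<omega>)) (z k) \<noteq> 0" using m[of k] that by auto
      then have "det (char_matrix (?M \<omega>) (z k)) \<noteq> 0"
        using eigenvalue_det[OF Mc[OF \<omega>(1)]] eigenvalue_root_char_poly[OF Mc[OF \<omega>(1)]] by blast
      from inv_minor_sum_ge_of_close_roots[OF Mc[OF \<omega>(1)] xy(1) this s(1) xz yz]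
      have "\<omega> \<in> H (node k (p,q))" using \<omega>(1) by (simp add: H_def t_def z_def)
      then show ?thesis using pq unfolding F_def by blast
    qed
    then show "\<omega> \<in> (\<Union>m. \<Inter>k\<in>{m..}. F k)" by blast
  qed
  have "(\<Union>m. \<Inter>k\<in>{m..}. F k) \<in> sets P" using Fm by (intro sets.countable_UN sets.countable_INT'') auto
  then have "prob ?E \<le> prob (\<Union>m. \<Inter>k\<in>{m..}. F k)" by (rule finite_measure_mono[OF sub])
  also have "\<dots> \<le> 25 * R\<^sup>2 / s\<^sup>2 * b" by (intro measure_liminf_le Fm Fp)
  also have "b \<le> real n ^ 4 * ((4 * L) * (324 * K ^ 4 * (real n)\<^sup>2 / \<delta> ^ 4)) / t"
  proof -
    let ?C = "324 * K ^ 3 * (real n)\<^sup>2 / \<delta> ^ 4"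
    have C1: "1 \<le> ?C"
    proof -
      have "\<delta> ^ 4 \<le> 1 * 1 * 1" using \<delta> by (simp add: power_le_one)
      also have "1 * 1 * 1 \<le> 324 * K ^ 3 * (real n)\<^sup>2"
        using K n by (intro mult_mono one_le_power) auto
      finally have "\<delta> ^ 4 \<le> 324 * K ^ 3 * (real n)\<^sup>2" by simp
      then show ?thesis using \<delta> by (simp add: field_simps)
    qed
    have "real m \<le> 4 * log 2 (1 / s) + 1" unfolding m_def using log0 by linarith
    moreover have "log 2 (1 / s) + 1 \<le> L"
    proof -
      have "log 2 (1 / s) + 1 = log 2 (2 / s)" using s by (simp add: log_divide log_mult)
      also have "\<dots> \<le> L" unfolding L_def using s R by (intro log_mono divide_right_mono) auto
      finally show ?thesis .
    qed
    ultimately have mL: "1 + real m \<le> 4 * L" using log0 by linarith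
    have "1 + real m * ?C \<le> (1 + real m) * ?C" unfolding distrib_right using C1 by linarith
    also have "\<dots> \<le> (4 * L) * (324 * K ^ 4 * (real n)\<^sup>2 / \<delta> ^ 4)"
      using mL K \<delta> by (intro mult_mono divide_right_mono mult_right_mono mult_left_mono power_increasing) auto
    finally show ?thesis unfolding b_def using t0 by (intro divide_right_mono mult_left_mono) auto
  qed
  then have "25 * R\<^sup>2 / s\<^sup>2 * b \<le> 25 * R\<^sup>2 / s\<^sup>2 * (real n ^ 4 * ((4 * L) * (324 * K ^ 4 * (real n)\<^sup>2 / \<delta> ^ 4)) / t)"
    by (intro mult_left_mono) auto
  also have "\<dots> = 4665600 * L * R\<^sup>2 * K ^ 4 * real n ^ 6 * (s\<^sup>2 / \<delta> ^ 4)"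
  proof -
    have e: "W / s\<^sup>2 * (V / t) = 144 * s\<^sup>2 * (W * V)" for W V
      using s by (simp add: t_def field_simps power2_eq_square power4_eq_xxxx)
    have n6: "real n ^ 6 = real n ^ 4 * (real n)\<^sup>2" by (simp flip: power_add)
    show ?thesis unfolding e n6 by (simp add: mult_ac)
  qed
  finally show ?case by (simp add: L_def R_def)
qed

end
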